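(* Let $E$ be a uniformly smooth real Banach space, $D\subseteq E$ a nonempty closed convex subset, and $T:D\to D$ a nonexpansive mapping with $F(T)\neq\emptyset$. Let $f_n,g_n:D\to D$ ($n\ge0$) be mappings, and let $\{x_n\}$ be defined by $x_0\in D$ and, for $n\ge0$, $$y_n=\beta_n g_n(x_n)+(1-\beta_n)Tx_n,\qquad x_{n+1}=\alpha_n f_n(x_n)+(1-\alpha_n)Ty_n.$$ Assume: (i) there is $L\in(0,1)$ with $\|f_n(x)-f_n(y)\|\le L\|x-y\|$ for all $x,y\in D$ and all $n$, and $f_n\to f$ uniformly on $D$ for some $f\in\Pi_D$; (ii) there are a constant $M>0$ and nonnegative numbers $\delta_n$ with $\sum_{n=0}^\infty\delta_n<\infty$ such that $\beta_n\|g_n(x)-x\|\le\delta_n(\|x\|+M)$ for all $x\in D$ and all $n$; (iii) $\alpha_n\in[0,1]$, $\alpha_n\to0$ and $\sum_{n=0}^\infty\alpha_n=\infty$; (iv) $\beta_n\in(0,1]$; (v) $\{x_n\}$ is bounded and $\|Tx_n-x_n\|\to0$. Then $\{x_n\}$ converges strongly to $Q(f)$.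
   Context: $F(T)=\{x\in D: Tx=x\}$ denotes the fixed point set of $T$. $\Pi_D$ denotes the set of contractions on $D$: maps $f:D\to D$ for which there is $\alpha\in(0,1)$ with $\|f(x)-f(y)\|\le\alpha\|x-y\|$ for all $x,y\in D$. For $f\in\Pi_D$ and $t\in(0,1)$, let $x_t\in D$ be the unique solution of $x_t=tf(x_t)+(1-t)Tx_t$. When $E$ is uniformly smooth and $F(T)\neq\emptyset$, the strong limit $\lim_{t\to0^+}x_t$ exists and lies in $F(T)$ (a known result of Xu); the map $Q:\Pi_D\to F(T)$ is defined by $Q(f):=\lim_{t\to0^+}x_t$. *)

theory Defs
  imports "HOL-Analysis.Analysis"
begin

text \<open>Uniform smoothness: the modulus of smoothness
  rho(tau) = sup {(norm(x+y)+norm(x-y))/2 - 1 : norm x = 1, norm y <= tau}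
  satisfies rho(tau)/tau -> 0 as tau -> 0+. Written out without Sup.\<close>
definition uniformly_smooth :: "('a::real_normed_vector) itself \<Rightarrow> bool" where
  "uniformly_smooth _ \<longleftrightarrow>
     (\<forall>\<epsilon>>0. \<exists>\<delta>>0. \<forall>\<tau>. 0 < \<tau> \<and> \<tau> < \<delta> \<longrightarrow>
        (\<forall>x y::'a. norm x = 1 \<and> norm y \<le> \<tau> \<longrightarrow>
           (norm (x + y) + norm (x - y)) / 2 - 1 \<le> \<epsilon> * \<tau>))"

definition nonexpansive_on :: "'a::real_normed_vector set \<Rightarrow> ('a \<Rightarrow> 'a) \<Rightarrow> bool" where
  "nonexpansive_on D T \<longleftrightarrow> T ` D \<subseteq> D \<and> (\<forall>x\<in>D. \<forall>y\<in>D. norm (T x - T y) \<le> norm (x - y))"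

definition fixpoints :: "'a set \<Rightarrow> ('a \<Rightarrow> 'a) \<Rightarrow> 'a set" where
  "fixpoints D T = {x\<in>D. T x = x}"

definition contractions :: "'a::real_normed_vector set \<Rightarrow> ('a \<Rightarrow> 'a) set" where
  "contractions D = {f. f ` D \<subseteq> D \<and>
     (\<exists>\<alpha>. 0 < \<alpha> \<and> \<alpha> < 1 \<and> (\<forall>x\<in>D. \<forall>y\<in>D. norm (f x - f y) \<le> \<alpha> * norm (x - y)))}"

definition xt :: "'a::real_normed_vector set \<Rightarrow> ('a \<Rightarrow> 'a) \<Rightarrow> ('a \<Rightarrow> 'a) \<Rightarrow> real \<Rightarrow> 'a" where
  "xt D T f t = (THE x. x \<in> D \<and> x = t *\<^sub>R f x + (1 - t) *\<^sub>R T x)"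

definition Qmap :: "'a::real_normed_vector set \<Rightarrow> ('a \<Rightarrow> 'a) \<Rightarrow> ('a \<Rightarrow> 'a) \<Rightarrow> 'a" where
  "Qmap D T f = Lim (at_right 0) (\<lambda>t. xt D T f t)"

end

theory Submission
  imports Defs "HOL-Library.Diagonal_Subsequence"
begin

text \<open>
  The duality mapping is avoided: every estimate compares norms along a segment.
  The path \<open>x_t = t u + (1 - t) T x_t\<close> converges because its asymptotic center \<open>q\<close> may be chosen in
  \<open>F(T)\<close>. Nonexpansiveness of \<open>T\<close> makes \<open>x_t - q + s (u - q)\<close> longer than \<open>(1 + s) (x_t - q)\<close>, so by
  smoothness \<open>q + s (u - q)\<close> would be a strictly better center unless \<open>x_t\<close> tends to \<open>q\<close>. The existence of
  such a \<open>q\<close> rests on two consequences of uniform smoothness: decreasing sequences of bounded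
  closed convex sets intersect, and nonexpansive self-maps of such sets have fixed points.
  A contraction \<open>f\<close> is reduced to the constant anchor \<open>u = f q\<close>, where \<open>q\<close> is the fixed point of
  \<open>f\<close> followed by the limit map. For the iteration, moving from \<open>x_n\<close> in the direction \<open>q - u\<close>
  asymptotically brings no gain in the distance to \<open>q\<close>; this turns the recursion into
  \<open>a_(n+1) \<le> (1 - g_n) a_n + g_n k + c_n\<close> whenever \<open>a_(n+1) \<ge> k\<close>, where \<open>a_n\<close> is the distance from
  \<open>x_n\<close> to \<open>q\<close>, the sum of the \<open>g_n\<close> diverges and that of the \<open>c_n\<close> converges.
\<close>

section \<open>Nested convex sets in uniformly smooth spaces\<close>

text \<open>Dividing both vectors by \<open>norm x\<close> reduces to the normalized definition with
  \<open>\<tau> = norm y / norm x\<close>. Smoothness enters all later estimates through this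
  homogeneous form.\<close>

lemma uniformly_smooth_norm_sum:
  assumes "uniformly_smooth TYPE('a::real_normed_vector)" and "e > 0"
  obtains d where "d > 0"
    and "\<And>x y::'a. norm y \<le> d * norm x \<Longrightarrow> norm (x + y) + norm (x - y) \<le> 2 * norm x + e * norm y"
proof -
  from assms obtain d0 where d0: "d0 > 0" and *: "\<And>\<tau> (x::'a) y. 0 < \<tau> \<Longrightarrow> \<tau> < d0 \<Longrightarrow> norm x = 1 \<Longrightarrow> norm y \<le> \<tau> \<Longrightarrow>
      (norm (x + y) + norm (x - y)) / 2 - 1 \<le> (e/2) * \<tau>"
    unfolding uniformly_smooth_def by (metis half_gt_zero)
  show ?thesis
  \<comment> \<open>Halving \<open>d0\<close> turns the weak bound on \<open>norm y\<close> into the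
    strict \<open>\<tau> < d0\<close>; for \<open>x = 0\<close> that bound forces
    \<open>y = 0\<close>.\<close>
  proof (rule that[of "d0/2"])
    fix x y :: 'a
    assume le: "norm y \<le> d0/2 * norm x"
    show "norm (x + y) + norm (x - y) \<le> 2 * norm x + e * norm y"
    proof (cases "y = 0 \<or> x = 0")
      case True
      then show ?thesis using le by auto
    next
      case False
      define n where "n = norm x"
      have n: "n > 0" using False by (simp add: n_def)
      define \<tau> where "\<tau> = norm y / n"
      have \<tau>: "0 < \<tau>" "\<tau> < d0"
      proof -
        show "0 < \<tau>" using False n by (simp add: \<tau>_def)
        have "\<tau> \<le> d0/2" using le n by (simp add: \<tau>_def n_def field_simps)
        then show "\<tau> < d0" using d0 by simp
      qed
      have "(norm (x /\<^sub>R n + y /\<^sub>R n) + norm (x /\<^sub>R n - y /\<^sub>R n)) / 2 - 1 \<le> (e/2) * \<tau>"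
        using n by (intro *[OF \<tau>]) (auto simp: n_def \<tau>_def divide_inverse)
      moreover have "norm (x /\<^sub>R n + y /\<^sub>R n) = norm (x + y) / n" "norm (x /\<^sub>R n - y /\<^sub>R n) = norm (x - y) / n"
        using n by (simp_all flip: scaleR_right_distrib scaleR_right_diff_distrib add: divide_inverse)
      ultimately show ?thesis
        using n by (simp add: \<tau>_def n_def[symmetric] field_simps)
    qed
  qed (use d0 in auto)
qed

text \<open>
  If \<open>y\<close> almost minimizes the limiting distance \<open>m\<close> to the sets and \<open>z_n \<in> C n\<close> is almost nearest to \<open>y\<close>,
  then convexity bounds \<open>z_n - y + l (z_N - y)\<close> from below by about \<open>(1 + l) m\<close>, so by smoothness
  \<open>y + l (z_N - y)\<close> is closer to all the \<open>z_n\<close> than \<open>m\<close> allows.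
\<close>

lemma nested_convex_near_point:
  fixes C :: "nat \<Rightarrow> 'a::real_normed_vector set"
  assumes smooth: "uniformly_smooth TYPE('a)"
    and ne: "\<And>n. C n \<noteq> {}" and conv: "\<And>n. convex (C n)"
    and dec: "\<And>m n. m \<le> n \<Longrightarrow> C n \<subseteq> C m" and bdd: "bounded (C 0)" and e: "e > 0"
  shows "\<exists>y. \<forall>n. \<exists>z\<in>C n. norm (z - y) < e"
proof -
  define A where "A = {d. d > 0 \<and> (\<exists>y. \<forall>n. \<exists>z\<in>C n. norm (z - y) < d)}"
  define m where "m = Inf A"
  have A_ne: "A \<noteq> {}"
  proof -
    obtain B where B: "\<And>z. z \<in> C 0 \<Longrightarrow> norm z \<le> B"
      using bdd unfolding bounded_iff by auto
    have "\<exists>z\<in>C n. norm (z - 0) < \<bar>B\<bar> + 1" for n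
    proof -
      obtain z where "z \<in> C n" using ne by blast
      moreover then have "norm z \<le> B" using dec[of 0 n] B by auto
      ultimately show ?thesis by force
    qed
    then have "\<bar>B\<bar> + 1 \<in> A" unfolding A_def by (auto intro!: exI[of _ 0])
    then show ?thesis by auto
  qed
  have A_bdd: "bdd_below A" unfolding A_def by (rule bdd_belowI[of _ 0]) auto
  have m_le: "m \<le> d" if "d \<in> A" for d using that A_bdd by (simp add: m_def cInf_lower)
  have "m < e"
  proof (rule ccontr)
    assume "\<not> m < e"
    then have m: "m > 0" using e by simp
    obtain d where d: "d > 0" and sm: "\<And>x y::'a. norm y \<le> d * norm x \<Longrightarrow>
        norm (x + y) + norm (x - y) \<le> 2 * norm x + (1/8) * norm y"
      using uniformly_smooth_norm_sum[OF smooth, of "1/8"] by auto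
    \<comment> \<open>With \<open>norm b < 2 * m\<close> and
      \<open>norm (z n - y) \<ge> m / 2\<close>, the bound \<open>l \<le> d/4\<close> makes
      \<open>l *\<^sub>R b\<close> admissible in \<open>sm\<close>. The smoothness error is then at
      most \<open>l * m / 4\<close>, and \<open>\<theta> = l/16\<close> keeps the remaining relative
      errors \<open>3 * \<theta> + l * \<theta>\<close> below \<open>l/2\<close>.\<close>
    define l where "l = min 1 (d/4)"
    define \<theta> where "\<theta> = l/16"
    have l: "0 < l" "l \<le> 1" "l \<le> d/4" and \<theta>: "0 < \<theta>" "\<theta> \<le> 1/16"
      using d by (auto simp: l_def \<theta>_def)
    obtain r where "r \<in> A" and r: "r < m * (1 + \<theta>)"
      using cInf_lessD[OF A_ne, of "m * (1 + \<theta>)"] m \<theta> by (auto simp: m_def[symmetric])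
    then obtain y where y: "\<And>n. \<exists>z\<in>C n. norm (z - y) < r"
      by (auto simp: A_def)
    then obtain z where z: "\<And>n. z n \<in> C n" "\<And>n. norm (z n - y) < r" by metis
    have "m * (1 - \<theta>) \<notin> A" using m_le[of "m * (1 - \<theta>)"] mult_pos_pos[OF m \<theta>(1)] by (auto simp: algebra_simps)
    then obtain N where N: "\<And>z. z \<in> C N \<Longrightarrow> norm (z - y) \<ge> m * (1 - \<theta>)"
      using m \<theta> unfolding A_def by (auto simp: not_less) (meson not_less)
    define b where "b = z N - y"
    have b: "norm b < 2 * m"
    proof -
      have "m * (1 + \<theta>) \<le> m * 2" using m \<theta> by (intro mult_left_mono) auto
      then show ?thesis using z(2)[of N] r by (simp add: b_def)
    qed
    have key: "norm (z n - (y + l *\<^sub>R b)) < (1 - l/4) * m" if "n \<ge> N" for n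
    proof -
      have zn: "z n \<in> C N" using z(1) dec that by auto
      \<comment> \<open>Divided by \<open>1 + l\<close>, the vector
        \<open>(z n - y) + l *\<^sub>R b\<close> is a convex combination of \<open>z n\<close> and
        \<open>z N\<close> minus \<open>y\<close>. The combination lies in \<open>C N\<close>, whose
        points are at least \<open>m * (1 - \<theta>)\<close> away from \<open>y\<close>.\<close>
      have "(1/(1+l)) *\<^sub>R z n + (l/(1+l)) *\<^sub>R z N \<in> C N"
        using conv[of N] zn z(1)[of N] l by (intro convexD) (auto simp: field_simps)
      then have "norm ((1/(1+l)) *\<^sub>R z n + (l/(1+l)) *\<^sub>R z N - y) \<ge> m * (1 - \<theta>)" by (rule N)
      moreover have "(1/(1+l)) *\<^sub>R z n + (l/(1+l)) *\<^sub>R z N - y = (1/(1+l)) *\<^sub>R ((z n - y) + l *\<^sub>R b)"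
      proof -
        have "(1/(1+l)) *\<^sub>R y + (l/(1+l)) *\<^sub>R y = y"
          using l by (simp flip: scaleR_left_distrib add: field_simps)
        moreover have "(1/(1+l)) *\<^sub>R ((z n - y) + l *\<^sub>R b)
            = (1/(1+l)) *\<^sub>R z n + (l/(1+l)) *\<^sub>R z N - ((1/(1+l)) *\<^sub>R y + (l/(1+l)) *\<^sub>R y)"
          by (simp add: b_def algebra_simps)
        ultimately show ?thesis by simp
      qed
      ultimately have "m * (1 - \<theta>) \<le> norm ((1/(1+l)) *\<^sub>R ((z n - y) + l *\<^sub>R b))" by simp
      also have "\<dots> = norm ((z n - y) + l *\<^sub>R b) / (1 + l)" using l by simp
      finally have "m * (1 - \<theta>) \<le> norm ((z n - y) + l *\<^sub>R b) / (1 + l)" .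
      then have low: "norm ((z n - y) + l *\<^sub>R b) \<ge> (1 + l) * (m * (1 - \<theta>))"
        using l by (simp add: pos_le_divide_eq mult.commute)
      have "norm (z n - y) \<ge> m / 2"
      proof -
        have "m * (1/2) \<le> m * (1 - \<theta>)" using m \<theta> by (intro mult_left_mono) auto
        then show ?thesis using N[OF zn] by simp
      qed
      moreover have "l * norm b \<le> (d/4) * (2 * m)"
        using b l d by (intro mult_mono) auto
      moreover have "d * (m / 2) \<le> d * norm (z n - y)"
        using calculation(1) d by (intro mult_left_mono) auto
      moreover have "(d/4) * (2 * m) = d * (m / 2)" by simp
      ultimately have "l * norm b \<le> d * norm (z n - y)" by linarith
      then have "norm (l *\<^sub>R b) \<le> d * norm (z n - y)" using l by simp
      from sm[OF this] have "norm ((z n - y) - l *\<^sub>R b) \<le> 2 * r + (1/8) * (l * norm b) - (1 + l) * (m * (1 - \<theta>))"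
        using low z(2)[of n] l by simp
      also have "\<dots> < 2 * (m * (1 + \<theta>)) + (1/8) * (l * (2 * m)) - (1 + l) * (m * (1 - \<theta>))"
        using r mult_strict_left_mono[OF b l(1)] by linarith
      also have "\<dots> = m * (1 + 3 * \<theta> - l + l * \<theta> + l/4)" by (simp add: algebra_simps)
      also have "\<dots> \<le> m * (1 - l/4)"
      proof (intro mult_left_mono)
        have "l * \<theta> \<le> 1 * \<theta>" using l \<theta> by (intro mult_right_mono) auto
        then show "1 + 3 * \<theta> - l + l * \<theta> + l/4 \<le> 1 - l/4" using l \<theta>_def by linarith
      qed (use m in auto)
      finally show ?thesis by (simp add: algebra_simps)
    qed
    have "\<exists>w\<in>C n. norm (w - (y + l *\<^sub>R b)) < (1 - l/4) * m" for n
      using key[of "max n N"] z(1)[of "max n N"] dec[of n "max n N"] by auto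
    moreover have "(1 - l/4) * m > 0" using l m by simp
    ultimately have "(1 - l/4) * m \<in> A" unfolding A_def by blast
    from m_le[OF this] show False using mult_pos_pos[OF l(1) m] by (simp add: algebra_simps)
  qed
  then obtain d where "d \<in> A" "d < e" using cInf_lessD[OF A_ne] by (auto simp: m_def)
  then obtain y where "\<And>n. \<exists>z\<in>C n. norm (z - y) < d" by (auto simp: A_def)
  with \<open>d < e\<close> show ?thesis by (meson order_less_trans)
qed

text \<open>Cutting the whole family with a ball of radius \<open>(1/2)^k\<close> from the previous
  lemma leaves a nonempty nested convex family, so the cut can be iterated and diagonal points form
  a Cauchy sequence. The result stands in for weak compactness.\<close>

theorem nested_convex_Inter_nonempty:
  fixes C :: "nat \<Rightarrow> 'a::banach set"
  assumes smooth: "uniformly_smooth TYPE('a)"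
    and ne: "\<And>n. C n \<noteq> {}" and conv: "\<And>n. convex (C n)" and clo: "\<And>n. closed (C n)"
    and dec: "\<And>m n. m \<le> n \<Longrightarrow> C n \<subseteq> C m" and bdd: "bounded (C 0)"
  shows "(\<Inter>n. C n) \<noteq> {}"
proof -
  define good where "good K \<longleftrightarrow> (\<forall>n. K n \<noteq> {} \<and> convex (K n) \<and> K n \<subseteq> C n) \<and> (\<forall>m n. m \<le> n \<longrightarrow> K n \<subseteq> K m)"
    for K :: "nat \<Rightarrow> 'a set"
  define step where "step k K K' \<longleftrightarrow> (\<forall>n. K' n \<subseteq> K n) \<and> (\<exists>y. \<forall>n. K' n \<subseteq> cball y ((1/2)^k))"
    for k :: nat and K K' :: "nat \<Rightarrow> 'a set"
  have "\<exists>K. \<forall>k. good (K k) \<and> step k (K k) (K (Suc k))"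
  proof (rule dependent_nat_choice)
    show "\<exists>K. good K" using ne conv dec by (intro exI[of _ C]) (auto simp: good_def)
    fix K :: "nat \<Rightarrow> 'a set" and k :: nat
    assume K: "good K"
    have "bounded (K 0)" using K bdd bounded_subset by (auto simp: good_def)
    with K obtain y where y: "\<And>n. \<exists>z\<in>K n. norm (z - y) < (1/2)^k"
      using nested_convex_near_point[OF smooth, of K "(1/2)^k"] by (auto simp: good_def)
    define K' where "K' n = K n \<inter> cball y ((1/2)^k)" for n
    have "K' n \<noteq> {}" for n using y[of n] by (force simp: K'_def dist_norm norm_minus_commute)
    then have "good K'" using K unfolding good_def K'_def by (blast intro: convex_Int convex_cball)
    moreover have "step k K K'" by (auto simp: step_def K'_def)
    ultimately show "\<exists>K'. good K' \<and> step k K K'" by blast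
  qed
  then obtain K where K: "\<And>k. good (K k)" "\<And>k. step k (K k) (K (Suc k))" by blast
  have sub: "K j n \<subseteq> K k n" if "k \<le> j" for j k n
    using that
  proof (induction rule: dec_induct)
    case (step i)
    then show ?case using K(2)[of i] unfolding step_def by blast
  qed simp
  have "\<exists>y. y \<in> K k k" for k using K(1)[of k] unfolding good_def by blast
  then have "\<exists>c. \<forall>k. c k \<in> K k k" by (intro choice) blast
  then obtain c where c: "\<And>k. c k \<in> K k k" by auto
  have cC: "c k \<in> C n" if "n \<le> k" for k n
    using c[of k] K(1)[of k] dec[OF that] by (auto simp: good_def)
  have "Cauchy c"
  proof (rule metric_CauchyI)
    fix e :: real assume "e > 0"
    then obtain k where k: "(1/2)^k < e/2" using real_arch_pow_inv[of "e/2" "1/2"] by auto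
    \<comment> \<open>A single ball contains all sets of stage \<open>Suc k\<close>, hence every
      diagonal point from that stage on.\<close>
    obtain y where y: "\<And>n. K (Suc k) n \<subseteq> cball y ((1/2)^k)" using K(2)[of k] by (auto simp: step_def)
    have "dist y (c m) \<le> (1/2)^k" if "m \<ge> Suc k" for m
      using sub[OF that, of m] c[of m] y[of m] by auto
    then show "\<exists>M. \<forall>m\<ge>M. \<forall>n\<ge>M. dist (c m) (c n) < e"
      using k by (intro exI[of _ "Suc k"]) (smt (verit) dist_triangle3 field_sum_of_halves)
  qed
  then obtain l where l: "c \<longlonglongrightarrow> l" using convergent_eq_Cauchy by blast
  have "l \<in> C n" for n
    by (rule Lim_in_closed_set[OF clo[of n] _ _ l])
      (auto simp: eventually_sequentially intro!: exI[of _ n] cC)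
  then show ?thesis by auto
qed

section \<open>Eventual balls and tail hulls\<close>

text \<open>This is the set where the limit superior of \<open>norm (w t - y)\<close> along
  \<open>F\<close> is at most \<open>c\<close>, a sublevel set of the asymptotic radius. Quantifying
  over \<open>c'\<close> expresses this without a limit superior.\<close>

definition eventual_cball :: "'b filter \<Rightarrow> ('b \<Rightarrow> 'a::real_normed_vector) \<Rightarrow> real \<Rightarrow> 'a set" where
  "eventual_cball F w c = {y. \<forall>c'>c. \<forall>\<^sub>F t in F. norm (w t - y) < c'}"

lemma eventual_cballD:
  "y \<in> eventual_cball F w c \<Longrightarrow> c < c' \<Longrightarrow> \<forall>\<^sub>F t in F. norm (w t - y) < c'"
  by (auto simp: eventual_cball_def)

lemma eventual_cball_mono: "c \<le> c' \<Longrightarrow> eventual_cball F w c \<subseteq> eventual_cball F w c'"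
  by (auto simp: eventual_cball_def)

lemma eventual_cballI:
  assumes "\<forall>\<^sub>F t in F. norm (w t - y) \<le> c"
  shows "y \<in> eventual_cball F w c"
  unfolding eventual_cball_def using assms by (auto elim!: eventually_mono)

lemma closed_eventual_cball: "closed (eventual_cball F w c)"
  unfolding closed_sequential_limits
proof (intro allI impI, elim conjE)
  fix ys l assume ys: "\<forall>n. ys n \<in> eventual_cball F w c" and lim: "ys \<longlonglongrightarrow> l"
  show "l \<in> eventual_cball F w c"
    unfolding eventual_cball_def
  proof (intro CollectI allI impI)
    fix c' assume c': "c < c'"
    then have "(c' - c) / 2 > 0" by simp
    with lim obtain n where n: "norm (ys n - l) < (c' - c) / 2"
      unfolding LIMSEQ_iff by blast
    have "\<forall>\<^sub>F t in F. norm (w t - ys n) < (c + c') / 2"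
      using ys c' by (intro eventual_cballD) auto
    then show "\<forall>\<^sub>F t in F. norm (w t - l) < c'"
    proof (rule eventually_mono)
      fix t assume t: "norm (w t - ys n) < (c + c') / 2"
      have "norm (w t - l) \<le> norm (w t - ys n) + norm (ys n - l)"
        using norm_triangle_ineq[of "w t - ys n" "ys n - l"] by simp
      also have "\<dots> < (c + c') / 2 + (c' - c) / 2" using n t by linarith
      also have "\<dots> = c'" by (simp add: field_simps)
      finally show "norm (w t - l) < c'" .
    qed
  qed
qed

lemma convex_eventual_cball: "convex (eventual_cball F w c)"
proof (rule convexI)
  fix x y and u v :: real
  assume x: "x \<in> eventual_cball F w c" and y: "y \<in> eventual_cball F w c" and uv: "0 \<le> u" "0 \<le> v" "u + v = 1"
  show "u *\<^sub>R x + v *\<^sub>R y \<in> eventual_cball F w c"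
    unfolding eventual_cball_def
  proof (intro CollectI allI impI)
    fix c' assume "c < c'"
    from eventual_cballD[OF x this] eventual_cballD[OF y this]
    show "\<forall>\<^sub>F t in F. norm (w t - (u *\<^sub>R x + v *\<^sub>R y)) < c'"
    proof eventually_elim
      case (elim t)
      then have "x \<in> ball (w t) c'" "y \<in> ball (w t) c'" by (auto simp: dist_norm)
      then have "u *\<^sub>R x + v *\<^sub>R y \<in> ball (w t) c'"
        using convex_ball uv by (intro convexD) auto
      then show ?case by (auto simp: dist_norm)
    qed
  qed
qed

text \<open>Along \<open>F\<close> the point \<open>w t\<close> is almost fixed, so its distance to
  \<open>T y\<close> is almost that of \<open>T (w t)\<close> to \<open>T y\<close>. This invariance
  allows fixed points to be sought inside sublevel sets.\<close>

lemma eventual_cball_nonexpansive: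
  assumes T: "nonexpansive_on D T" and w: "\<forall>\<^sub>F t in F. w t \<in> D"
    and fix_approx: "((\<lambda>t. T (w t) - w t) \<longlongrightarrow> 0) F"
    and y: "y \<in> D" "y \<in> eventual_cball F w c"
  shows "T y \<in> eventual_cball F w c"
  unfolding eventual_cball_def
proof (intro CollectI allI impI)
  fix c' assume c': "c < c'"
  have "\<forall>\<^sub>F t in F. norm (w t - y) < (c + c') / 2"
    using y c' by (intro eventual_cballD) auto
  moreover have "\<forall>\<^sub>F t in F. norm (T (w t) - w t) < (c' - c) / 2"
    using tendstoD[OF fix_approx, of "(c' - c) / 2"] c' by simp
  ultimately show "\<forall>\<^sub>F t in F. norm (w t - T y) < c'"
    using w
  proof eventually_elim
    case (elim t)
    have "norm (w t - T y) \<le> norm (T (w t) - w t) + norm (T (w t) - T y)"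
      using norm_triangle_ineq[of "w t - T (w t)" "T (w t) - T y"] by (simp add: norm_minus_commute)
    also have "norm (T (w t) - T y) \<le> norm (w t - y)"
      using T elim y by (auto simp: nonexpansive_on_def)
    finally have "norm (w t - T y) \<le> norm (T (w t) - w t) + norm (w t - y)" by simp
    then show ?case using elim(1,2) by argo
  qed
qed

lemma eventual_cball_bound:
  assumes F: "F \<noteq> bot" and y: "y \<in> eventual_cball F w c" and w: "\<forall>\<^sub>F t in F. norm (w t) \<le> B"
  shows "norm y \<le> B + c"
proof (rule field_le_epsilon)
  fix e :: real assume "e > 0"
  then have "\<forall>\<^sub>F t in F. norm (w t - y) < c + e" using y by (intro eventual_cballD) auto
  with w have "\<forall>\<^sub>F t in F. norm y \<le> B + c + e"
    by eventually_elim (smt (verit) norm_triangle_ineq2 norm_minus_commute)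
  then show "norm y \<le> B + c + e" using F by simp
qed

text \<open>Points common to all tail hulls play the role of weak cluster points of
  \<open>w\<close>.\<close>

definition tail_hull :: "(nat \<Rightarrow> 'a::real_normed_vector) \<Rightarrow> nat \<Rightarrow> 'a set" where
  "tail_hull w m = closure (convex hull (w ` {m..}))"

lemma tail_hull_subset:
  assumes "closed K" "convex K" "\<And>n. n \<ge> m \<Longrightarrow> w n \<in> K"
  shows "tail_hull w m \<subseteq> K"
  unfolding tail_hull_def using assms by (intro closure_minimal hull_minimal) auto

lemma tail_hull_self: "m \<le> n \<Longrightarrow> w n \<in> tail_hull w m"
  unfolding tail_hull_def by (meson closure_subset hull_subset image_eqI atLeast_iff subsetD)

lemma closed_tail_hull: "closed (tail_hull w m)" by (simp add: tail_hull_def)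

lemma convex_tail_hull: "convex (tail_hull w m)"
  by (simp add: tail_hull_def convex_closure convex_convex_hull)

lemma tail_hull_antimono: "m \<le> n \<Longrightarrow> tail_hull w n \<subseteq> tail_hull w m"
  by (intro tail_hull_subset closed_tail_hull convex_tail_hull tail_hull_self) auto

text \<open>A closed ball containing a tail contains its closed convex hull. This replaces weak
  lower semicontinuity of the norm.\<close>

lemma tail_hull_dist_le:
  assumes z: "\<And>m. z \<in> tail_hull w m" and w: "\<forall>\<^sub>F n in sequentially. norm (w n - y) \<le> b"
  shows "norm (z - y) \<le> b"
proof -
  obtain N where N: "\<And>n. n \<ge> N \<Longrightarrow> norm (w n - y) \<le> b"
    using w unfolding eventually_sequentially by auto
  have "tail_hull w N \<subseteq> cball y b"
    using N by (intro tail_hull_subset) (auto simp: dist_norm norm_minus_commute)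
  then show ?thesis using z[of N] by (auto simp: dist_norm norm_minus_commute)
qed

lemma tail_hull_Inter_nonempty:
  fixes w :: "nat \<Rightarrow> 'a::banach"
  assumes smooth: "uniformly_smooth TYPE('a)" and w: "bounded (range w)"
  obtains z where "\<And>m. z \<in> tail_hull w m"
proof -
  have "(\<Inter>m. tail_hull w m) \<noteq> {}"
  proof (rule nested_convex_Inter_nonempty[OF smooth])
    show "tail_hull w n \<noteq> {}" for n using tail_hull_self[of n n w] by auto
    show "bounded (tail_hull w 0)"
      unfolding tail_hull_def using w
      by (intro bounded_closure bounded_convex_hull) (auto intro: bounded_subset)
  qed (auto simp: closed_tail_hull convex_tail_hull dest: tail_hull_antimono)
  then show ?thesis using that by auto
qed

section \<open>Normal structure for sequences\<close>

text \<open>Closing \<open>A\<close> under rational affine combinations keeps it countable, and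
  density of the rationals makes the closure convex. A diagonal argument over \<open>S\<close> can
  then control a whole closed convex hull.\<close>

lemma rational_affine_closure:
  fixes A :: "'a::real_normed_vector set"
  assumes "countable A"
  obtains S where "countable S" "A \<subseteq> S" "convex (closure S)"
proof -
  \<comment> \<open>All rational coefficients are allowed, not only those in the unit interval, so
    that their closure is the whole line; \<open>q = 0\<close> makes the stages increase.\<close>
  define step where "step X = (\<lambda>((x, y), q). (1 - q) *\<^sub>R x + q *\<^sub>R y) ` ((X \<times> X) \<times> (\<rat> :: real set))" for X :: "'a set"
  define S where "S = (\<Union>n. (step ^^ n) A)"
  have cnt: "countable ((step ^^ n) A)" for n
    by (induction n) (auto simp: step_def assms countable_rat intro!: countable_image countable_SIGMA)
  have inc: "X \<subseteq> step X" for X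
  proof
    fix x assume "x \<in> X"
    then show "x \<in> step X" unfolding step_def by (intro image_eqI[of _ _ "((x, x), 0)"]) auto
  qed
  have mono: "(step ^^ m) A \<subseteq> (step ^^ n) A" if "m \<le> n" for m n
    using that by (induction rule: dec_induct) (use inc in auto)
  have S_closed: "(1 - q) *\<^sub>R x + q *\<^sub>R y \<in> S" if xy: "x \<in> S" "y \<in> S" and q: "q \<in> \<rat>" for x y q
  proof -
    obtain m n where "x \<in> (step ^^ m) A" "y \<in> (step ^^ n) A" using xy by (auto simp: S_def)
    then have "x \<in> (step ^^ max m n) A" "y \<in> (step ^^ max m n) A"
      using mono[of m "max m n"] mono[of n "max m n"] by auto
    then have "(1 - q) *\<^sub>R x + q *\<^sub>R y \<in> (step ^^ Suc (max m n)) A"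
      using q by (auto simp: step_def intro!: image_eqI[of _ _ "((x, y), q)"])
    then show ?thesis unfolding S_def by blast
  qed
  have "convex (closure S)"
  proof (rule convexI)
    fix x y and u v :: real
    assume xy: "x \<in> closure S" "y \<in> closure S" and uv: "0 \<le> u" "0 \<le> v" "u + v = 1"
    have "(\<lambda>((x, y), q). (1 - q) *\<^sub>R x + q *\<^sub>R y) ` closure ((S \<times> S) \<times> (\<rat> :: real set)) \<subseteq> closure S"
    proof (rule image_closure_subset)
      show "continuous_on (closure ((S \<times> S) \<times> (\<rat> :: real set))) (\<lambda>((x, y), q). (1 - q) *\<^sub>R x + q *\<^sub>R y)"
        unfolding case_prod_beta by (intro continuous_intros)
      show "(\<lambda>((x, y), q). (1 - q) *\<^sub>R x + q *\<^sub>R y) ` ((S \<times> S) \<times> (\<rat> :: real set)) \<subseteq> closure S"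
        using S_closed closure_subset by fastforce
    qed simp
    moreover have "((x, y), v) \<in> closure ((S \<times> S) \<times> (\<rat> :: real set))"
      using xy by (simp add: closure_Times Rats_closure_real)
    ultimately have "(1 - v) *\<^sub>R x + v *\<^sub>R y \<in> closure S" by force
    moreover have "1 - v = u" using uv by simp
    ultimately show "u *\<^sub>R x + v *\<^sub>R y \<in> closure S" by simp
  qed
  moreover have "countable S" unfolding S_def using cnt by auto
  moreover have "A \<subseteq> S" unfolding S_def by (rule subset_trans[OF _ UN_upper[of 0]]) auto
  ultimately show ?thesis using that by blast
qed

lemma convergent_norm_subseq_countable:
  fixes w :: "nat \<Rightarrow> 'a::real_normed_vector"
  assumes w: "bounded (range w)" and S: "countable S"
  obtains r where "strict_mono r" "\<And>y. y \<in> S \<Longrightarrow> convergent (\<lambda>n. norm (w (r n) - y))"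
proof (cases "S = {}")
  case True
  then show ?thesis using that[of id] by (simp add: strict_mono_id)
next
  case False
  with S obtain s :: "nat \<Rightarrow> 'a" where s: "S = range s" by (metis uncountable_def)
  interpret subseqs "\<lambda>i r. convergent (\<lambda>n. norm (w (r n) - s i))"
  proof
    fix i and r :: "nat \<Rightarrow> nat"
    assume "strict_mono r"
    have "bounded (range (\<lambda>n. w (r n)))" by (rule bounded_subset[OF w]) auto
    then have "bounded (range (\<lambda>n. w (r n) - s i))"
      using bounded_minus_comp[of "\<lambda>n. w (r n)" UNIV "\<lambda>_. s i"] by simp
    then have "bounded (range (\<lambda>n. norm (w (r n) - s i)))" by (simp add: bounded_iff)
    then obtain l r' where "strict_mono r'" "((\<lambda>n. norm (w (r n) - s i)) \<circ> r') \<longlonglongrightarrow> l"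
      using bounded_imp_convergent_subsequence by blast
    then show "\<exists>r'. strict_mono r' \<and> convergent (\<lambda>n. norm (w ((r \<circ> r') n) - s i))"
      by (auto simp: o_def convergent_def)
  qed
  have "convergent (\<lambda>n. norm (w (diagseq n) - s i))" for i
  proof -
    \<comment> \<open>The diagonal sequence is known to refine the selection made for
      \<open>s i\<close> only after \<open>Suc i\<close> terms; the initial segment is irrelevant
      for convergence.\<close>
    have "convergent (\<lambda>n. norm (w ((diagseq \<circ> (+) (Suc i)) n) - s i))"
    proof (rule diagseq_holds)
      fix r r' :: "nat \<Rightarrow> nat" and n
      assume "strict_mono r" "convergent (\<lambda>k. norm (w (r' k) - s n))"
      then show "convergent (\<lambda>k. norm (w ((r' \<circ> r) k) - s n))"
        using convergent_subseq_convergent[of "\<lambda>k. norm (w (r' k) - s n)" r] by (simp add: o_def)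
    qed
    then show ?thesis
      using convergent_ignore_initial_segment[of "\<lambda>n. norm (w (diagseq n) - s i)" "Suc i"]
      by (simp add: o_def add.commute)
  qed
  then show ?thesis using that[of diagseq] subseq_diagseq s by auto
qed

text \<open>The distance to \<open>y\<close> is 1-Lipschitz in \<open>y\<close> uniformly along the
  sequence, so convergence passes from a countable set to its closure. For a subsequence of this
  kind, a bound that holds infinitely often is a bound on the limit.\<close>

lemma convergent_norm_subseq:
  fixes w :: "nat \<Rightarrow> 'a::real_normed_vector"
  assumes w: "bounded (range w)"
  obtains r where "strict_mono r" "\<And>y. y \<in> tail_hull w 0 \<Longrightarrow> convergent (\<lambda>n. norm (w (r n) - y))"
proof -
  obtain S where S: "countable S" "range w \<subseteq> S" "convex (closure S)"
    using rational_affine_closure[of "range w"] by auto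
  obtain r where r: "strict_mono r" "\<And>y. y \<in> S \<Longrightarrow> convergent (\<lambda>n. norm (w (r n) - y))"
    by (rule convergent_norm_subseq_countable[OF w S(1)]) blast
  have "convergent (\<lambda>n. norm (w (r n) - y))" if y: "y \<in> closure S" for y
    unfolding Cauchy_convergent_iff[symmetric]
  proof (rule metric_CauchyI)
    fix e :: real assume e: "e > 0"
    then obtain y' where y': "y' \<in> S" "dist y' y < e/3"
      using closure_approachableD[OF y, of "e/3"] by (auto simp: dist_commute)
    have near: "\<bar>norm (w (r n) - y) - norm (w (r n) - y')\<bar> < e/3" for n
      using y'(2) norm_triangle_ineq3[of "w (r n) - y" "w (r n) - y'"] by (simp add: dist_norm)
    obtain N where N: "\<And>m n. m \<ge> N \<Longrightarrow> n \<ge> N \<Longrightarrow> dist (norm (w (r m) - y')) (norm (w (r n) - y')) < e/3"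
      using metric_CauchyD[OF convergent_Cauchy[OF r(2)[OF y'(1)]], of "e/3"] e by auto
    have "dist (norm (w (r m) - y)) (norm (w (r n) - y)) < e" if "m \<ge> N" "n \<ge> N" for m n
      using near[of m] near[of n] N[OF that] unfolding dist_real_def by linarith
    then show "\<exists>M. \<forall>m\<ge>M. \<forall>n\<ge>M. dist (norm (w (r m) - y)) (norm (w (r n) - y)) < e" by blast
  qed
  moreover have "tail_hull w 0 \<subseteq> closure S"
    using S closure_subset by (intro tail_hull_subset) auto
  ultimately show ?thesis using that[OF r(1)] by blast
qed

lemma tail_hull_subseq:
  assumes "strict_mono r"
  shows "tail_hull (w \<circ> r) m \<subseteq> tail_hull w m"
proof (intro tail_hull_subset closed_tail_hull convex_tail_hull)
  fix n assume "m \<le> n"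
  then have "m \<le> r n" using seq_suble[OF assms, of n] by simp
  then show "(w \<circ> r) n \<in> tail_hull w m" by (simp add: tail_hull_self)
qed

text \<open>
  The constant \<open>c\<close> depends on the space only. A point \<open>z\<close> of all tail hulls serves unless infinitely
  many \<open>w k\<close> are almost \<open>R\<close> away from it; then smoothness at \<open>w k - w n\<close> in the direction \<open>w k - z\<close>
  shows that \<open>(1 - s) w k + s z\<close> serves, and a limit of these points lies in all tail hulls again.
\<close>

lemma normal_structure_sequence:
  assumes smooth: "uniformly_smooth TYPE('a::banach)"
  obtains c :: real where "0 < c" "c < 1"
    and "\<And>(w :: nat \<Rightarrow> 'a) R. R > 0 \<Longrightarrow> (\<And>k l. norm (w k - w l) \<le> R) \<Longrightarrow>
      \<exists>r z. strict_mono r \<and> (\<forall>m. z \<in> tail_hull (w \<circ> r) m) \<and> z \<in> eventual_cball sequentially (w \<circ> r) (c * R)"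
proof -
  obtain d where d: "d > 0" and sm: "\<And>x y::'a. norm y \<le> d * norm x \<Longrightarrow>
      norm (x + y) + norm (x - y) \<le> 2 * norm x + (1/4) * norm y"
    using uniformly_smooth_norm_sum[OF smooth, of "1/4"] by auto
  \<comment> \<open>The bound \<open>s \<le> d/2\<close> makes steps of length at most
    \<open>s * R\<close> admissible in \<open>sm\<close> at vectors longer than \<open>R/2\<close>;
    shorter vectors are handled by the triangle inequality, as \<open>1/2 + s \<le> c\<close>. The
    choice \<open>c = 1 - s/8\<close> gives \<open>2 + s/4 - (1 + s) * c \<le> c\<close> in the
    final estimate.\<close>
  define s where "s = min (1/4) (d/2)"
  have s: "0 < s" "s \<le> 1/4" "s \<le> d/2" using d by (auto simp: s_def)
  define c where "c = 1 - s/8"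
  have c: "0 < c" "c < 1" using s by (auto simp: c_def)
  have main: "\<exists>r z. strict_mono r \<and> (\<forall>m. z \<in> tail_hull (w \<circ> r) m) \<and> z \<in> eventual_cball sequentially (w \<circ> r) (c * R)"
    if R: "R > 0" and sep0: "\<And>k l. norm (w k - w l) \<le> R" for w :: "nat \<Rightarrow> 'a" and R
  proof -
    have bdd: "bounded (range w)"
      by (rule bounded_subset[OF bounded_cball[of "w 0" R]]) (auto simp: dist_norm sep0)
    obtain r where r: "strict_mono r" "\<And>y. y \<in> tail_hull w 0 \<Longrightarrow> convergent (\<lambda>n. norm (w (r n) - y))"
      by (rule convergent_norm_subseq[OF bdd]) blast
    define v where "v = w \<circ> r"
    have sep: "norm (v k - v l) \<le> R" for k l using sep0 by (simp add: v_def)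
    have bdd_v: "bounded (range v)" unfolding v_def using bdd by (rule bounded_subset) auto
    have conv: "convergent (\<lambda>n. norm (v n - y))" if "y \<in> tail_hull v 0" for y
      using r(2)[of y] tail_hull_subseq[OF r(1), of w 0] that by (auto simp: v_def o_def)
    obtain z where z: "\<And>m. z \<in> tail_hull v m" by (rule tail_hull_Inter_nonempty[OF smooth bdd_v]) blast
    have "\<exists>z. (\<forall>m. z \<in> tail_hull v m) \<and> z \<in> eventual_cball sequentially v (c * R)"
    proof (cases "z \<in> eventual_cball sequentially v (c * R)")
      case True
      then show ?thesis using z by blast
    next
      case False
      obtain l where l: "(\<lambda>n. norm (v n - z)) \<longlonglongrightarrow> l" using conv[OF z] by (auto simp: convergent_def)
      have "l > c * R"
      proof (rule ccontr)
        assume "\<not> l > c * R"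
        then have "z \<in> eventual_cball sequentially v (c * R)"
          unfolding eventual_cball_def using order_tendstoD(2)[OF l] by auto
        with False show False by simp
      qed
      then obtain N where N: "\<And>k. k \<ge> N \<Longrightarrow> norm (v k - z) > c * R"
        using order_tendstoD(1)[OF l] unfolding eventually_sequentially by blast
      define y where "y k = (1 - s) *\<^sub>R v (k + N) + s *\<^sub>R z" for k
      have y_hull: "y k \<in> tail_hull v m" if "m \<le> k" for k m
        unfolding y_def using convex_tail_hull[of v m] tail_hull_self[of m "k + N" v] z[of m] that s
        by (intro convexD) auto
      have y_good: "y k \<in> eventual_cball sequentially v (c * R)" for k
      proof -
        define x where "x = v (k + N) - z"
        have x: "norm x > c * R" "norm x \<le> R"
        proof -
          show "norm x > c * R" using N[of "k + N"] by (simp add: x_def)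
          have "norm (z - v (k + N)) \<le> R"
            using z sep by (intro tail_hull_dist_le[of z v]) auto
          then show "norm x \<le> R" by (simp add: x_def norm_minus_commute)
        qed
        have y_eq: "v n - y k = - ((v (k + N) - v n) - s *\<^sub>R x)" for n
          by (simp add: y_def x_def algebra_simps)
        \<comment> \<open>Otherwise a tail of \<open>v\<close> lies in the ball of radius
          \<open>(1 + s) * (c * R)\<close> about \<open>v (k + N) + s *\<^sub>R x\<close>. That ball
          would also contain \<open>z\<close>, whose distance from its center is
          \<open>(1 + s) * norm x\<close>.\<close>
        have low: "\<exists>\<^sub>F n in sequentially. (1 + s) * (c * R) < norm ((v (k + N) - v n) + s *\<^sub>R x)"
        proof (rule ccontr)
          assume "\<not> ?thesis"
          then have "\<forall>\<^sub>F n in sequentially. norm (v n - (v (k + N) + s *\<^sub>R x)) \<le> (1 + s) * (c * R)"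
            unfolding not_frequently by (rule eventually_mono) (simp add: not_less norm_minus_commute algebra_simps)
          from tail_hull_dist_le[OF z this] have "norm (- ((1 + s) *\<^sub>R x)) \<le> (1 + s) * (c * R)"
            by (simp add: x_def algebra_simps)
          then show False using x(1) s by simp
        qed
        have freq: "\<exists>\<^sub>F n in sequentially. norm (v n - y k) \<le> c * R"
          using low
        proof (rule frequently_elim1)
          fix n assume n: "(1 + s) * (c * R) < norm ((v (k + N) - v n) + s *\<^sub>R x)"
          let ?p = "v (k + N) - v n"
          have p: "norm ?p \<le> R" by (rule sep)
          have sx: "norm (s *\<^sub>R x) \<le> s * R" using x s by simp
          have "norm (?p - s *\<^sub>R x) \<le> c * R"
          proof (cases "norm ?p \<le> R/2")
            case True
            have "norm (?p - s *\<^sub>R x) \<le> R/2 + s * R"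
              using norm_triangle_ineq4[of ?p "s *\<^sub>R x"] True sx by linarith
            also have "\<dots> = (1/2 + s) * R" by (simp add: algebra_simps)
            also have "\<dots> \<le> c * R" using R s by (intro mult_right_mono) (auto simp: c_def)
            finally show ?thesis .
          next
            case False
            have "s * R \<le> (d/2) * R" using s R by (intro mult_right_mono) auto
            also have "\<dots> \<le> d * norm ?p" using False d by simp
            finally have "norm (s *\<^sub>R x) \<le> d * norm ?p" using sx by linarith
            from sm[OF this] have "norm (?p - s *\<^sub>R x) \<le> 2 * R + (1/4) * (s * R) - (1 + s) * (c * R)"
              using n p sx by linarith
            also have "\<dots> = (2 + s/4 - (1 + s) * c) * R" by (simp add: algebra_simps)
            also have "\<dots> \<le> c * R"
            proof (rule mult_right_mono)
              have "s * s \<le> s * (1/4)" using s by (intro mult_left_mono) auto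
              then show "2 + s/4 - (1 + s) * c \<le> c" using s unfolding c_def by (simp add: algebra_simps)
            qed (use R in simp)
            finally show ?thesis .
          qed
          then show "norm (v n - y k) \<le> c * R" by (simp only: y_eq norm_minus_cancel)
        qed
        obtain b where b: "(\<lambda>n. norm (v n - y k)) \<longlonglongrightarrow> b"
          using conv[OF y_hull[of 0 k]] by (auto simp: convergent_def)
        \<comment> \<open>Since the distances converge, the bound from \<open>freq\<close>, valid
          infinitely often, passes to their limit.\<close>
        have "b \<le> c * R"
        proof (rule ccontr)
          assume "\<not> b \<le> c * R"
          then have "\<forall>\<^sub>F n in sequentially. c * R < norm (v n - y k)" using order_tendstoD(1)[OF b] by simp
          with freq show False by (simp add: frequently_def not_le)
        qed
        then show ?thesis unfolding eventual_cball_def using order_tendstoD(2)[OF b] by auto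
      qed
      have "bounded (range y)"
      proof -
        have "bounded (tail_hull v 0)"
          unfolding tail_hull_def using bdd_v
          by (intro bounded_closure bounded_convex_hull) (auto intro: bounded_subset)
        then show ?thesis using y_hull[of 0] by (auto intro: bounded_subset)
      qed
      then obtain z' where z': "\<And>m. z' \<in> tail_hull y m" using tail_hull_Inter_nonempty[OF smooth] by blast
      have "z' \<in> tail_hull v m" for m
        using z'[of m] tail_hull_subset[OF closed_tail_hull convex_tail_hull, of m y v m] y_hull by auto
      moreover have "z' \<in> eventual_cball sequentially v (c * R)"
        using z'[of 0] tail_hull_subset[OF closed_eventual_cball convex_eventual_cball, of 0 y] y_good by auto
      ultimately show ?thesis by blast
    qed
    then show ?thesis using r(1) by (auto simp: v_def)
  qed
  show ?thesis by (rule that[OF c main])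
qed

section \<open>Fixed points of nonexpansive maps\<close>

definition invariant_hull :: "('a::real_normed_vector \<Rightarrow> 'a) \<Rightarrow> 'a set \<Rightarrow> 'a set" where
  "invariant_hull T A = (\<lambda>K. closed K \<and> convex K \<and> T ` K \<subseteq> K) hull A"

lemma invariant_hull:
  "A \<subseteq> invariant_hull T A" "closed (invariant_hull T A)" "convex (invariant_hull T A)"
  "T ` invariant_hull T A \<subseteq> invariant_hull T A"
  unfolding invariant_hull_def hull_def by (auto intro!: closed_Inter convex_Inter)

lemma invariant_hull_minimal:
  "A \<subseteq> K \<Longrightarrow> closed K \<Longrightarrow> convex K \<Longrightarrow> T ` K \<subseteq> K \<Longrightarrow> invariant_hull T A \<subseteq> K"
  unfolding invariant_hull_def by (rule hull_minimal) auto

text \<open>Minimality is used twice. If \<open>a\<close> is within \<open>r\<close> of the whole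
  hull \<open>G\<close>, then the part of \<open>G\<close> within \<open>r\<close> of
  \<open>T a\<close> contains \<open>z\<close> and is invariant, so it is all of \<open>G\<close>.
  Hence the set \<open>H\<close> of such points is invariant and contains \<open>z\<close>, so it is
  all of \<open>G\<close> too. The diameter bound is \<open>r\<close> rather than the obvious
  \<open>2 r\<close>, so that a factor \<open>c < 1\<close> can be gained.\<close>

lemma invariant_hull_diameter:
  assumes T: "nonexpansive_on (invariant_hull T {z}) T"
    and r: "invariant_hull T {z} \<subseteq> cball z r"
    and y: "y \<in> invariant_hull T {z}" "y' \<in> invariant_hull T {z}"
  shows "norm (y - y') \<le> r"
proof -
  define G where "G = invariant_hull T {z}"
  note G = invariant_hull[where A = "{z}" and T = T, folded G_def]
  have T': "norm (T a - T b) \<le> norm (a - b)" if "a \<in> G" "b \<in> G" for a b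
    using T that by (auto simp: nonexpansive_on_def G_def)
  define H where "H = {a \<in> G. \<forall>b\<in>G. norm (a - b) \<le> r}"
  have H_eq: "H = G \<inter> (\<Inter>b\<in>G. cball b r)"
    by (auto simp: H_def dist_norm norm_minus_commute)
  have "G \<subseteq> H"
    unfolding G_def
  proof (rule invariant_hull_minimal)
    show "{z} \<subseteq> H" using G(1) r by (auto simp: H_def G_def[symmetric] dist_norm)
    show "closed H" unfolding H_eq using G by (intro closed_Int closed_INT) auto
    show "convex H" unfolding H_eq using G by (intro convex_Int convex_INT) auto
    show "T ` H \<subseteq> H"
    proof safe
      fix a assume a: "a \<in> H"
      then have aG: "a \<in> G" "T a \<in> G" using G(4) by (auto simp: H_def)
      have "G \<subseteq> G \<inter> cball (T a) r"
        unfolding G_def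
      proof (rule invariant_hull_minimal[of "{z}"], unfold G_def[symmetric])
        show "{z} \<subseteq> G \<inter> cball (T a) r" using G(1) aG r by (auto simp: G_def[symmetric] dist_commute)
        show "T ` (G \<inter> cball (T a) r) \<subseteq> G \<inter> cball (T a) r"
        proof safe
          fix b assume b: "b \<in> G"
          then show "T b \<in> G" using G(4) by auto
          have "norm (T a - T b) \<le> norm (a - b)" using T' aG b by simp
          also have "\<dots> \<le> r" using a b by (simp add: H_def)
          finally show "T b \<in> cball (T a) r" by (simp add: dist_norm)
        qed
      qed (use G in \<open>auto intro: convex_Int\<close>)
      then show "T a \<in> H" using aG by (auto simp: H_def dist_norm)
    qed
  qed
  then show ?thesis using y by (auto simp: H_def G_def)
qed

lemma nonexpansive_on_subset: "nonexpansive_on D T \<Longrightarrow> K \<subseteq> D \<Longrightarrow> T ` K \<subseteq> K \<Longrightarrow> nonexpansive_on K T"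
  unfolding nonexpansive_on_def by blast

text \<open>The right-hand side contracts with factor \<open>t * a + (1 - t) < 1\<close>. Admitting
  \<open>a = 0\<close> covers constant anchors.\<close>

lemma anchored_path_ex1:
  fixes D :: "'a::banach set"
  assumes D: "closed D" "convex D" and T: "nonexpansive_on D T"
    and f: "f ` D \<subseteq> D" "\<And>x y. x \<in> D \<Longrightarrow> y \<in> D \<Longrightarrow> norm (f x - f y) \<le> a * norm (x - y)" and a: "0 \<le> a" "a < 1"
    and t: "0 < t" "t \<le> 1" and ne: "D \<noteq> {}"
  shows "\<exists>!x. x \<in> D \<and> x = t *\<^sub>R f x + (1 - t) *\<^sub>R T x"
proof -
  have "\<exists>!x\<in>D. t *\<^sub>R f x + (1 - t) *\<^sub>R T x = x"
  proof (rule Banach_fix)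
    show "complete D" using D by (simp add: complete_eq_closed)
    have "t * a < t" using a t by simp
    then show "t * a + (1 - t) < 1" by simp
    show "0 \<le> t * a + (1 - t)" using a t by simp
    show "(\<lambda>x. t *\<^sub>R f x + (1 - t) *\<^sub>R T x) ` D \<subseteq> D"
      using D(2) t f(1) T by (auto simp: nonexpansive_on_def intro!: convexD)
    fix x y assume xy: "x \<in> D" "y \<in> D"
    have "norm (t *\<^sub>R f x + (1 - t) *\<^sub>R T x - (t *\<^sub>R f y + (1 - t) *\<^sub>R T y))
        = norm (t *\<^sub>R (f x - f y) + (1 - t) *\<^sub>R (T x - T y))" by (simp add: algebra_simps)
    also have "\<dots> \<le> t * norm (f x - f y) + (1 - t) * norm (T x - T y)"
      using norm_triangle_ineq[of "t *\<^sub>R (f x - f y)" "(1 - t) *\<^sub>R (T x - T y)"] t by simp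
    also have "\<dots> \<le> t * (a * norm (x - y)) + (1 - t) * norm (x - y)"
      using f(2)[OF xy] T xy t by (intro add_mono mult_left_mono) (auto simp: nonexpansive_on_def)
    finally show "dist (t *\<^sub>R f x + (1 - t) *\<^sub>R T x) (t *\<^sub>R f y + (1 - t) *\<^sub>R T y) \<le> (t * a + (1 - t)) * dist x y"
      by (simp add: dist_norm algebra_simps)
  qed (use ne in auto)
  then show ?thesis by metis
qed

text \<open>The solution with parameter \<open>t\<close> and constant anchor \<open>u\<close>
  satisfies \<open>T x - x = t *\<^sub>R (T x - u)\<close>, which is small because \<open>D\<close>
  is bounded.\<close>

lemma approximate_fixed_points:
  fixes D :: "'a::banach set"
  assumes D: "closed D" "convex D" "bounded D" "D \<noteq> {}" and T: "nonexpansive_on D T"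
  obtains w where "\<And>n. w n \<in> D" "(\<lambda>n. T (w n) - w n) \<longlonglongrightarrow> 0"
proof -
  obtain u where u: "u \<in> D" using D by auto
  obtain B where B: "\<And>x. x \<in> D \<Longrightarrow> norm x \<le> B" using D by (auto simp: bounded_iff)
  have "\<exists>x. x \<in> D \<and> x = inverse (real (Suc n)) *\<^sub>R u + (1 - inverse (real (Suc n))) *\<^sub>R T x" for n
    using anchored_path_ex1[OF D(1,2) T, of "\<lambda>_. u" 0 "inverse (real (Suc n))"] u D
    by (auto simp: inverse_le_1_iff)
  then obtain w where w: "\<And>n. w n \<in> D" "\<And>n. w n = inverse (real (Suc n)) *\<^sub>R u + (1 - inverse (real (Suc n))) *\<^sub>R T (w n)"
    by metis
  have "norm (T (w n) - w n) \<le> inverse (real (Suc n)) * (2 * B)" for n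
  proof -
    define t where "t = inverse (real (Suc n))"
    have "T (w n) - w n = T (w n) - (t *\<^sub>R u + (1 - t) *\<^sub>R T (w n))"
      using w(2)[of n] unfolding t_def by (rule arg_cong)
    also have "\<dots> = t *\<^sub>R (T (w n) - u)" by (simp add: algebra_simps)
    finally have eq: "T (w n) - w n = t *\<^sub>R (T (w n) - u)" .
    have "T (w n) \<in> D" using T w(1)[of n] by (auto simp: nonexpansive_on_def)
    then have "norm (T (w n) - u) \<le> 2 * B"
      using norm_triangle_ineq4[of "T (w n)" u] B[OF u] B[of "T (w n)"] by simp
    then have "norm (t *\<^sub>R (T (w n) - u)) \<le> t * (2 * B)"
      by (simp add: t_def mult_left_mono)
    then show ?thesis unfolding eq unfolding t_def .
  qed
  moreover have "(\<lambda>n. inverse (real (Suc n)) * (2 * B)) \<longlonglongrightarrow> 0"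
    using tendsto_mult_left_zero[OF LIMSEQ_inverse_real_of_nat] .
  ultimately have "(\<lambda>n. T (w n) - w n) \<longlonglongrightarrow> 0"
    by (rule Lim_null_comparison[OF always_eventually[OF allI]])
  then show ?thesis using that[of w, OF w(1)] by blast
qed

text \<open>Repeatedly choosing a new center in the invariant hull of the old one shrinks the radius
  of the hull by the factor \<open>c\<close>. The centers converge geometrically, and
  \<open>T\<close> moves each by at most its radius, so the limit is fixed.\<close>

theorem nonexpansive_fixed_point:
  fixes C :: "'a::banach set"
  assumes smooth: "uniformly_smooth TYPE('a)"
    and C: "closed C" "convex C" "bounded C" "C \<noteq> {}" and T: "nonexpansive_on C T"
  shows "\<exists>q\<in>C. T q = q"
proof -
  obtain c :: real where c: "0 < c" "c < 1"
    and ns: "\<And>(w :: nat \<Rightarrow> 'a) R. R > 0 \<Longrightarrow> (\<And>k l. norm (w k - w l) \<le> R) \<Longrightarrow>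
      \<exists>r z. strict_mono r \<and> (\<forall>m. z \<in> tail_hull (w \<circ> r) m) \<and> z \<in> eventual_cball sequentially (w \<circ> r) (c * R)"
    by (rule normal_structure_sequence[OF smooth]) blast
  define G where "G z = invariant_hull T {z}" for z
  have GC: "G z \<subseteq> C" if "z \<in> C" for z
    unfolding G_def using that C T by (intro invariant_hull_minimal) (auto simp: nonexpansive_on_def)
  note G = invariant_hull[where A = "{z}" and T = T for z, folded G_def]
  have GT: "nonexpansive_on (G z) T" if "z \<in> C" for z
    using nonexpansive_on_subset[OF T GC[OF that] G(4)] .
  \<comment> \<open>Normal structure is applied to approximate fixed points inside
    \<open>G z\<close>, which are at most \<open>R\<close> apart by the diameter bound.\<close>
  have step: "\<exists>z'\<in>G z. G z' \<subseteq> cball z' (c * R)" if z: "z \<in> C" "G z \<subseteq> cball z R" and R: "R > 0" for z R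
  proof -
    have diam: "norm (y - y') \<le> R" if "y \<in> G z" "y' \<in> G z" for y y'
      using invariant_hull_diameter[of T z R y y'] GT[OF z(1)] z(2) that by (simp add: G_def)
    obtain w where w: "\<And>n. w n \<in> G z" "(\<lambda>n. T (w n) - w n) \<longlonglongrightarrow> 0"
    proof (rule approximate_fixed_points[OF G(2,3) _ _ GT[OF z(1)]])
      show "bounded (G z)" by (rule bounded_subset[OF bounded_cball z(2)])
      show "G z \<noteq> {}" using G(1)[of z] by auto
    qed blast
    have "norm (w k - w l) \<le> R" for k l using diam w(1) by simp
    from ns[of R w, OF R this] obtain r z' where r: "strict_mono r" and z': "\<And>m. z' \<in> tail_hull (w \<circ> r) m"
      "z' \<in> eventual_cball sequentially (w \<circ> r) (c * R)"
      by blast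
    have z'G: "z' \<in> G z"
      using z'(1)[of 0] tail_hull_subset[OF G(2,3), of 0 "w \<circ> r"] w(1) by auto
    let ?E = "eventual_cball sequentially (w \<circ> r) (c * R)"
    \<comment> \<open>\<open>?E\<close> is invariant because the sequence is almost fixed, so
      minimality puts the hull of \<open>z'\<close> inside it. Its points are then close to
      \<open>z'\<close> itself, since \<open>z'\<close> lies in every tail hull.\<close>
    have "G z' \<subseteq> G z \<inter> ?E"
      unfolding G_def[of z']
    proof (rule invariant_hull_minimal)
      show "T ` (G z \<inter> ?E) \<subseteq> G z \<inter> ?E"
      proof safe
        fix y assume y: "y \<in> G z" "y \<in> ?E"
        show "T y \<in> G z" using y G(4) by auto
        show "T y \<in> ?E"
          using w LIMSEQ_subseq_LIMSEQ[OF w(2) r] y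
          by (intro eventual_cball_nonexpansive[OF GT[OF z(1)]]) (auto simp: o_def)
      qed
      show "{z'} \<subseteq> G z \<inter> ?E" using z' z'G by simp
      show "closed (G z \<inter> ?E)" by (intro closed_Int G closed_eventual_cball)
      show "convex (G z \<inter> ?E)" by (intro convex_Int G convex_eventual_cball)
    qed
    moreover have "norm (z' - y) \<le> c * R" if "y \<in> ?E" for y
    proof (rule field_le_epsilon)
      fix e :: real assume "e > 0"
      then have "\<forall>\<^sub>F n in sequentially. norm ((w \<circ> r) n - y) < c * R + e"
        using eventual_cballD[OF that] by simp
      then have "\<forall>\<^sub>F n in sequentially. norm ((w \<circ> r) n - y) \<le> c * R + e"
        by (rule eventually_mono) simp
      then show "norm (z' - y) \<le> c * R + e" by (rule tail_hull_dist_le[OF z'(1)])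
    qed
    ultimately have "G z' \<subseteq> cball z' (c * R)" by (auto simp: dist_norm)
    then show ?thesis using z'G by blast
  qed
  obtain u where u: "u \<in> C" using C by auto
  obtain B where B: "B > 0" "\<And>x. x \<in> C \<Longrightarrow> norm x \<le> B" using C by (auto simp: bounded_pos)
  have "\<exists>z. \<forall>n. (z n \<in> C \<and> G (z n) \<subseteq> cball (z n) (c^n * (2*B))) \<and> z (Suc n) \<in> G (z n)"
  proof (rule dependent_nat_choice)
    have "norm (u - y) \<le> 2 * B" if "y \<in> C" for y
      using norm_triangle_ineq4[of u y] B(2)[OF u] B(2)[OF that] by simp
    then show "\<exists>z. z \<in> C \<and> G z \<subseteq> cball z (c^0 * (2*B))"
      using u GC[OF u] by (intro exI[of _ u]) (auto simp: dist_norm)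
    fix z n assume z: "z \<in> C \<and> G z \<subseteq> cball z (c^n * (2*B))"
    have "c^n * (2*B) > 0" using c B by simp
    then obtain z' where z': "z' \<in> G z" "G z' \<subseteq> cball z' (c * (c^n * (2*B)))"
      using step[of z "c^n * (2*B)"] z by blast
    have "z' \<in> C" using GC z z'(1) by blast
    moreover have "c * (c^n * (2*B)) = c^Suc n * (2*B)" by simp
    ultimately show "\<exists>z'. (z' \<in> C \<and> G z' \<subseteq> cball z' (c^Suc n * (2*B))) \<and> z' \<in> G z"
      using z' by metis
  qed
  then obtain z where z: "\<And>n. z n \<in> C" "\<And>n. G (z n) \<subseteq> cball (z n) (c^n * (2*B))" "\<And>n. z (Suc n) \<in> G (z n)"
    by blast
  have rad: "norm (y - z n) \<le> c^n * (2*B)" if "y \<in> G (z n)" for y n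
    using z(2)[of n] that by (auto simp: dist_norm norm_minus_commute)
  have pow0: "(\<lambda>n. c^n * (2*B)) \<longlonglongrightarrow> 0"
    using c by (intro tendsto_mult_left_zero LIMSEQ_power_zero) auto
  have "summable (\<lambda>n. norm (z (Suc n) - z n))"
  proof (rule summable_comparison_test')
    show "summable (\<lambda>n. c^n * (2*B))" using c by (intro summable_mult2 summable_geometric) auto
    show "norm (norm (z (Suc n) - z n)) \<le> c^n * (2*B)" for n using rad[OF z(3)] by simp
  qed
  then have "summable (\<lambda>n. z (Suc n) - z n)" by (rule summable_norm_cancel)
  then have "convergent (\<lambda>n. \<Sum>k<n. z (Suc k) - z k)" by (simp add: summable_iff_convergent)
  then have "convergent (\<lambda>n. z n - z 0)" by (simp add: sum_lessThan_telescope)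
  then have "convergent (\<lambda>n. z n - z 0 + z 0)" by (rule convergent_add) (rule convergent_const)
  then obtain q where q: "z \<longlonglongrightarrow> q" by (auto simp: convergent_def)
  have qC: "q \<in> C" using C(1) z(1) q by (metis closed_sequential_limits)
  have "norm (T q - q) \<le> 0"
  proof (rule tendsto_le[OF _ _ tendsto_const[of "norm (T q - q)" sequentially]])
    show "(\<lambda>n. 2 * norm (z n - q) + c^n * (2*B)) \<longlonglongrightarrow> 0"
      using tendsto_add[OF tendsto_mult_right_zero[OF tendsto_norm_zero[OF LIM_zero[OF q]]] pow0] by simp
    show "\<forall>\<^sub>F n in sequentially. norm (T q - q) \<le> 2 * norm (z n - q) + c^n * (2*B)"
    proof (rule always_eventually, rule allI)
      fix n
      have 1: "norm (T q - T (z n)) \<le> norm (q - z n)" using T qC z(1) by (auto simp: nonexpansive_on_def)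
      have 2: "norm (T (z n) - z n) \<le> c^n * (2*B)" using rad[of "T (z n)" n] G(1,4)[of "z n"] by auto
      show "norm (T q - q) \<le> 2 * norm (z n - q) + c^n * (2*B)"
        using norm_triangle_ineq[of "T q - T (z n)" "T (z n) - z n"]
          norm_triangle_ineq[of "T q - z n" "z n - q"] 1 2 by (simp add: norm_minus_commute)
    qed
  qed simp
  then show ?thesis using qC by auto
qed

section \<open>Convergence of the implicit path\<close>

text \<open>The sublevel sets of the asymptotic radius are closed, convex, bounded and invariant
  under \<open>T\<close>. Those with radius above the infimum \<open>m\<close> are nonempty, so
  nestedness gives a minimizer, and the fixed point theorem inside the set of minimizers gives one
  fixed by \<open>T\<close>.\<close>

lemma asymptotic_center_fixed_point:
  fixes D :: "'a::banach set" and w :: "'b \<Rightarrow> 'a"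
  assumes smooth: "uniformly_smooth TYPE('a)"
    and D: "closed D" "convex D" "D \<noteq> {}" and T: "nonexpansive_on D T"
    and F: "F \<noteq> bot" and w: "\<forall>\<^sub>F t in F. w t \<in> D" "\<forall>\<^sub>F t in F. norm (w t) \<le> B"
    and fix_approx: "((\<lambda>t. T (w t) - w t) \<longlongrightarrow> 0) F"
  obtains q m where "q \<in> D" "T q = q" "q \<in> eventual_cball F w m"
    and "\<And>c. c < m \<Longrightarrow> D \<inter> eventual_cball F w c = {}"
proof -
  define S where "S c = D \<inter> eventual_cball F w c" for c
  define A where "A = {c. S c \<noteq> {}}"
  define m where "m = Inf A"
  have A_nonneg: "0 \<le> c" if "c \<in> A" for c
  proof (rule ccontr)
    assume "\<not> 0 \<le> c"
    then have "c < 0" by simp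
    obtain y where "y \<in> eventual_cball F w c" using \<open>c \<in> A\<close> by (auto simp: A_def S_def)
    from eventual_cballD[OF this \<open>c < 0\<close>] show False using F by simp
  qed
  have A_bdd: "bdd_below A" using A_nonneg by (rule bdd_belowI)
  obtain p where p: "p \<in> D" using D by auto
  have "B + norm p \<in> A"
  proof -
    have "p \<in> eventual_cball F w (B + norm p)"
    proof (rule eventual_cballI, rule eventually_mono[OF w(2)])
      show "norm (w t - p) \<le> B + norm p" if "norm (w t) \<le> B" for t
        using norm_triangle_ineq4[of "w t" p] that by simp
    qed
    then show ?thesis using p by (auto simp: A_def S_def)
  qed
  then have A_ne: "A \<noteq> {}" by auto
  have S_mono: "S c \<subseteq> S c'" if "c \<le> c'" for c c'
    using eventual_cball_mono[OF that, of F w] by (auto simp: S_def)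
  have S_ne: "S c \<noteq> {}" if "m < c" for c
  proof -
    obtain c' where "c' \<in> A" "c' < c" using cInf_lessD[OF A_ne] \<open>m < c\<close> by (auto simp: m_def)
    then show ?thesis using S_mono[of c' c] by (auto simp: A_def)
  qed
  have S_closed: "closed (S c)" and S_convex: "convex (S c)" for c
    unfolding S_def using D by (auto intro: closed_eventual_cball convex_eventual_cball convex_Int)
  have S_bdd: "bounded (S c)" for c
    by (rule boundedI[of _ "B + c"]) (auto simp: S_def eventual_cball_bound[OF F _ w(2)])
  have S_T: "T ` S c \<subseteq> S c" for c
    using eventual_cball_nonexpansive[OF T w(1) fix_approx] T by (auto simp: S_def nonexpansive_on_def)
  have "(\<Inter>n. S (m + inverse (real (Suc n)))) \<noteq> {}"
  proof (rule nested_convex_Inter_nonempty[OF smooth S_ne S_convex S_closed _ S_bdd])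
    show "m < m + inverse (real (Suc n))" for n by simp
    show "S (m + inverse (real (Suc n))) \<subseteq> S (m + inverse (real (Suc k)))" if "k \<le> n" for k n
      using that by (intro S_mono add_left_mono le_imp_inverse_le) auto
  qed
  moreover have "(\<Inter>n. S (m + inverse (real (Suc n)))) \<subseteq> S m"
  proof
    fix y assume y: "y \<in> (\<Inter>n. S (m + inverse (real (Suc n))))"
    have "y \<in> eventual_cball F w m"
      unfolding eventual_cball_def
    proof (intro CollectI allI impI)
      fix c' assume "m < c'"
      then obtain n where "inverse (real (Suc n)) < c' - m" using reals_Archimedean[of "c' - m"] by auto
      moreover have "y \<in> eventual_cball F w (m + inverse (real (Suc n)))" using y by (auto simp: S_def)
      ultimately show "\<forall>\<^sub>F t in F. norm (w t - y) < c'" by (intro eventual_cballD) auto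
    qed
    then show "y \<in> S m" using y by (auto simp: S_def)
  qed
  ultimately have "S m \<noteq> {}" by auto
  moreover have "nonexpansive_on (S m) T"
    by (rule nonexpansive_on_subset[OF T _ S_T]) (auto simp: S_def)
  ultimately obtain q where q: "q \<in> S m" "T q = q"
    using nonexpansive_fixed_point[OF smooth S_closed S_convex S_bdd] by blast
  have "S c = {}" if "c < m" for c
    using cInf_lower[OF _ A_bdd, of c] that by (auto simp: A_def m_def)
  then show ?thesis using that[of q m] q by (auto simp: S_def)
qed

lemma xt_solves:
  fixes D :: "'a::banach set"
  assumes D: "closed D" "convex D" "D \<noteq> {}" and T: "nonexpansive_on D T"
    and f: "f ` D \<subseteq> D" "\<And>x y. x \<in> D \<Longrightarrow> y \<in> D \<Longrightarrow> norm (f x - f y) \<le> a * norm (x - y)" and a: "0 \<le> a" "a < 1"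
    and t: "0 < t" "t \<le> 1"
  shows "xt D T f t \<in> D" "xt D T f t = t *\<^sub>R f (xt D T f t) + (1 - t) *\<^sub>R T (xt D T f t)"
  using theI'[OF anchored_path_ex1[OF D(1,2) T f a t D(3)]] by (auto simp: xt_def)

text \<open>The norm is convex along a ray: if it loses at most \<open>d\<close> up to parameter
  \<open>t\<close>, its slope after \<open>t\<close> is at least \<open>- d / t\<close>.\<close>

lemma norm_ray_ge:
  fixes a b :: "'a::real_normed_vector"
  assumes le: "norm a \<le> norm (a + t *\<^sub>R b) + d" and t: "0 < t" "t \<le> s" and d: "0 \<le> d"
  shows "norm (a + t *\<^sub>R b) \<le> norm (a + s *\<^sub>R b) + (s / t) * d"
proof -
  have s: "s > 0" using t by simp
  have "s *\<^sub>R (a + t *\<^sub>R b) = (s - t) *\<^sub>R a + t *\<^sub>R (a + s *\<^sub>R b)" by (simp add: algebra_simps)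
  then have "norm (s *\<^sub>R (a + t *\<^sub>R b)) \<le> norm ((s - t) *\<^sub>R a) + norm (t *\<^sub>R (a + s *\<^sub>R b))"
    by (metis norm_triangle_ineq)
  then have "s * norm (a + t *\<^sub>R b) \<le> (s - t) * norm a + t * norm (a + s *\<^sub>R b)"
    using t s by simp
  also have "\<dots> \<le> (s - t) * (norm (a + t *\<^sub>R b) + d) + t * norm (a + s *\<^sub>R b)"
    using le t by (intro add_mono mult_left_mono) auto
  finally have "t * norm (a + t *\<^sub>R b) \<le> t * norm (a + s *\<^sub>R b) + (s - t) * d" by (simp add: algebra_simps)
  also have "\<dots> \<le> t * norm (a + s *\<^sub>R b) + s * d" using t d by (simp add: mult_right_mono)
  also have "\<dots> = t * (norm (a + s *\<^sub>R b) + (s / t) * d)" using t by (simp add: field_simps)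
  finally show ?thesis using t by simp
qed

text \<open>Nonexpansiveness lets the \<open>T\<close> terms be absorbed on the left, and the common
  factor \<open>t\<close> cancels. The bound is therefore uniform in \<open>t\<close> and survives
  the limit.\<close>

lemma anchored_le:
  assumes T: "nonexpansive_on D T" and xy: "x \<in> D" "y \<in> D"
    and x: "x = t *\<^sub>R a + (1 - t) *\<^sub>R T x" and y: "y = t *\<^sub>R b + (1 - t) *\<^sub>R T y"
    and t: "0 < t" "t \<le> 1"
  shows "norm (x - y) \<le> norm (a - b)"
proof -
  have "x - y = (t *\<^sub>R a + (1 - t) *\<^sub>R T x) - (t *\<^sub>R b + (1 - t) *\<^sub>R T y)"
    using x y by (rule arg_cong2)
  also have "\<dots> = t *\<^sub>R (a - b) + (1 - t) *\<^sub>R (T x - T y)" by (simp add: algebra_simps)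
  finally have "norm (x - y) \<le> t * norm (a - b) + (1 - t) * norm (T x - T y)"
    using norm_triangle_ineq[of "t *\<^sub>R (a - b)" "(1 - t) *\<^sub>R (T x - T y)"] t by simp
  also have "\<dots> \<le> t * norm (a - b) + (1 - t) * norm (x - y)"
    using T xy t by (intro add_left_mono mult_left_mono) (auto simp: nonexpansive_on_def)
  finally have "t * norm (x - y) \<le> t * norm (a - b)" by (simp add: algebra_simps)
  then show ?thesis using t by simp
qed

text \<open>The point \<open>p\<close> lies on the segment from \<open>T p\<close> to
  \<open>u\<close>, and \<open>T p\<close> is no farther from \<open>x\<close> than
  \<open>p\<close>, up to \<open>norm (T x - x)\<close>. By convexity, moving on towards
  \<open>u\<close> cannot bring the point essentially closer to \<open>x\<close>.\<close>

lemma anchored_ray: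
  assumes T: "nonexpansive_on D T" and p: "p \<in> D" "p = t *\<^sub>R u + (1 - t) *\<^sub>R T p"
    and t: "0 < t" "t \<le> 1" and x: "x \<in> D" and s: "0 \<le> s" "s \<le> 1"
  shows "norm (p - x) \<le> norm ((p - x) + s *\<^sub>R (u - p)) + norm (T x - x) / t"
proof -
  \<comment> \<open>On the ray from \<open>T p\<close> towards \<open>u\<close>, the point
    \<open>p\<close> has parameter \<open>t\<close> and \<open>p + s *\<^sub>R (u - p)\<close> has
    parameter \<open>l\<close>.\<close>
  define l where "l = t + s * (1 - t)"
  have l: "t \<le> l" "l \<le> 1" using s t mult_right_mono[of s 1 "1 - t"] by (auto simp: l_def)
  have "(T p - x) + t *\<^sub>R (u - T p) = (t *\<^sub>R u + (1 - t) *\<^sub>R T p) - x" by (simp add: algebra_simps)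
  then have e1: "(T p - x) + t *\<^sub>R (u - T p) = p - x" by (simp only: p(2)[symmetric])
  have "(T p - x) + l *\<^sub>R (u - T p)
      = (1 - s) *\<^sub>R (t *\<^sub>R u + (1 - t) *\<^sub>R T p) + s *\<^sub>R u - x" by (simp add: l_def algebra_simps)
  also have "\<dots> = (1 - s) *\<^sub>R p + s *\<^sub>R u - x" by (simp only: p(2)[symmetric])
  finally have e2: "(T p - x) + l *\<^sub>R (u - T p) = (p - x) + s *\<^sub>R (u - p)" by (simp add: algebra_simps)
  have "norm (T p - x) \<le> norm (T p - T x) + norm (T x - x)"
    using norm_triangle_ineq[of "T p - T x" "T x - x"] by simp
  also have "norm (T p - T x) \<le> norm (p - x)" using T p(1) x by (simp add: nonexpansive_on_def)
  finally have "norm (T p - x) \<le> norm ((T p - x) + t *\<^sub>R (u - T p)) + norm (T x - x)" by (simp add: e1)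
  from norm_ray_ge[OF this t(1) l(1)]
  have "norm (p - x) \<le> norm ((p - x) + s *\<^sub>R (u - p)) + (l / t) * norm (T x - x)"
    by (simp only: e1 e2) simp
  also have "(l / t) * norm (T x - x) \<le> (1 / t) * norm (T x - x)"
    using l t by (intro mult_right_mono divide_right_mono) auto
  finally show ?thesis by simp
qed

text \<open>At a fixed point the error term of \<open>anchored_ray\<close> vanishes. Using it with
  parameter \<open>s / (1 + s)\<close> and scaling by \<open>1 + s\<close> changes the direction
  from \<open>u - p\<close> to \<open>u - q\<close>.\<close>

lemma anchored_expands:
  assumes T: "nonexpansive_on D T" and p: "p \<in> D" "p = t *\<^sub>R u + (1 - t) *\<^sub>R T p"
    and t: "0 < t" "t \<le> 1" and q: "q \<in> D" "T q = q" and s: "0 \<le> s"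
  shows "(1 + s) * norm (p - q) \<le> norm ((p - q) + s *\<^sub>R (u - q))"
proof -
  have "(1 + s) *\<^sub>R ((p - q) + (s / (1 + s)) *\<^sub>R (u - p)) = (1 + s) *\<^sub>R (p - q) + s *\<^sub>R (u - p)"
    using s by (simp add: scaleR_right_distrib)
  also have "\<dots> = (p - q) + s *\<^sub>R (u - q)" by (simp add: algebra_simps)
  finally have eq: "(1 + s) *\<^sub>R ((p - q) + (s / (1 + s)) *\<^sub>R (u - p)) = (p - q) + s *\<^sub>R (u - q)" .
  have "norm (p - q) \<le> norm ((p - q) + (s / (1 + s)) *\<^sub>R (u - p))"
    using anchored_ray[OF T p t q(1), of "s / (1 + s)"] q(2) s by simp
  then have "(1 + s) * norm (p - q) \<le> (1 + s) * norm ((p - q) + (s / (1 + s)) *\<^sub>R (u - p))"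
    using s by (intro mult_left_mono) auto
  also have "\<dots> = norm ((1 + s) *\<^sub>R ((p - q) + (s / (1 + s)) *\<^sub>R (u - p)))"
    using s by (simp only: norm_scaleR abs_of_nonneg)
  finally show ?thesis unfolding eq .
qed

theorem constant_path_convergent:
  fixes D :: "'a::banach set"
  assumes smooth: "uniformly_smooth TYPE('a)" and D: "closed D" "convex D"
    and T: "nonexpansive_on D T" "fixpoints D T \<noteq> {}" and u: "u \<in> D"
  obtains q where "q \<in> D" "T q = q" "(xt D T (\<lambda>_. u) \<longlongrightarrow> q) (at_right 0)"
proof -
  define path where "path = xt D T (\<lambda>_. u)"
  obtain p where p: "p \<in> D" "T p = p" using T(2) by (auto simp: fixpoints_def)
  then have ne: "D \<noteq> {}" by auto
  have path: "path t \<in> D" "path t = t *\<^sub>R u + (1 - t) *\<^sub>R T (path t)" if "0 < t" "t \<le> 1" for t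
    unfolding path_def
    by (rule xt_solves[OF D ne T(1), where a = 0]; use u that in \<open>simp add: image_subset_iff\<close>)+
  have unit: "\<forall>\<^sub>F t::real in at_right 0. 0 < t \<and> t \<le> 1"
    by (rule eventually_mono[OF eventually_at_right_real[of 0 1]]) auto
  have bnd: "norm (path t - p) \<le> norm (u - p)" if t: "0 < t" "t \<le> 1" for t
    using anchored_le[OF T(1) path(1)[OF t] p(1) path(2)[OF t] _ t, of p] p by (simp add: algebra_simps)
  have resid: "((\<lambda>t. T (path t) - path t) \<longlongrightarrow> 0) (at_right 0)"
  proof -
    have "\<forall>\<^sub>F t in at_right 0. norm (T (path t) - path t) \<le> t * (2 * norm (u - p))"
      using unit
    proof (rule eventually_mono)
      fix t :: real assume t: "0 < t \<and> t \<le> 1"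
      have "path t = t *\<^sub>R u + (1 - t) *\<^sub>R T (path t)" using t by (intro path(2)) auto
      then have "T (path t) - path t = T (path t) - (t *\<^sub>R u + (1 - t) *\<^sub>R T (path t))" by (rule arg_cong)
      also have "\<dots> = t *\<^sub>R (T (path t) - u)" by (simp add: algebra_simps)
      finally have "T (path t) - path t = t *\<^sub>R (T (path t) - u)" .
      moreover have "norm (T (path t) - T p) \<le> norm (path t - p)"
        using T(1) path(1)[of t] p(1) t unfolding nonexpansive_on_def by blast
      then have "norm (T (path t) - u) \<le> 2 * norm (u - p)"
        using norm_triangle_ineq4[of "T (path t) - p" "u - p"] p(2) bnd[of t] t by simp
      ultimately show "norm (T (path t) - path t) \<le> t * (2 * norm (u - p))" using t by (simp add: mult_left_mono)
    qed
    moreover have "((\<lambda>t::real. t * (2 * norm (u - p))) \<longlongrightarrow> 0) (at_right 0)"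
      by (intro tendsto_mult_left_zero tendsto_ident_at)
    ultimately show ?thesis by (rule Lim_null_comparison)
  qed
  have inD: "\<forall>\<^sub>F t in at_right 0. path t \<in> D"
    using unit by (rule eventually_mono) (auto intro: path)
  have bd: "\<forall>\<^sub>F t in at_right 0. norm (path t) \<le> norm (u - p) + norm p"
    using unit
  proof (rule eventually_mono)
    fix t :: real assume t: "0 < t \<and> t \<le> 1"
    then show "norm (path t) \<le> norm (u - p) + norm p"
      using bnd[of t] norm_triangle_sub[of "path t" p] by simp
  qed
  obtain q m where q: "q \<in> D" "T q = q" "q \<in> eventual_cball (at_right 0) path m"
    and m_min: "\<And>c. c < m \<Longrightarrow> D \<inter> eventual_cball (at_right 0) path c = {}"
    using asymptotic_center_fixed_point[OF smooth D ne T(1) trivial_limit_at_right_real inD bd resid] by blast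
  have "m \<le> 0"
  proof (rule ccontr)
    assume "\<not> m \<le> 0"
    then have m: "m > 0" by simp
    define v where "v = u - q"
    \<comment> \<open>This smoothness constant bounds the error by \<open>s * m / 2\<close>, against
      the gain of about \<open>s * m\<close> from \<open>anchored_expands\<close>; the summand 1
      covers \<open>v = 0\<close>.\<close>
    have "m / (2 * (norm v + 1)) > 0" using m by (simp add: add_nonneg_pos)
    then obtain d where d: "d > 0" and sm: "\<And>x y::'a. norm y \<le> d * norm x \<Longrightarrow>
        norm (x + y) + norm (x - y) \<le> 2 * norm x + m / (2 * (norm v + 1)) * norm y"
      using uniformly_smooth_norm_sum[OF smooth] by blast
    define s where "s = min 1 (min (m / 4) (d * m / 2) / (norm v + 1))"
    have v1: "norm v + 1 > 0" by (simp add: add_nonneg_pos)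
    have s: "0 < s" "s \<le> 1" using m d v1 by (auto simp: s_def)
    have sv: "s * norm v \<le> m / 4" "s * norm v \<le> d * (m / 2)"
    proof -
      have "s * norm v \<le> s * (norm v + 1)" using s by simp
      also have "\<dots> \<le> min (m / 4) (d * m / 2) / (norm v + 1) * (norm v + 1)"
        using v1 by (intro mult_right_mono) (auto simp: s_def)
      also have "\<dots> = min (m / 4) (d * m / 2)" using v1 by simp
      finally show "s * norm v \<le> m / 4" "s * norm v \<le> d * (m / 2)" by auto
    qed
    have "q + s *\<^sub>R v = (1 - s) *\<^sub>R q + s *\<^sub>R u" by (simp add: v_def algebra_simps)
    also have "\<dots> \<in> D" using D(2) q(1) u s by (intro convexD) auto
    finally have qD: "q + s *\<^sub>R v \<in> D" .
    have "\<forall>\<^sub>F t in at_right 0. norm (path t - q) < m + s * m / 8"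
      using s m by (intro eventual_cballD[OF q(3)]) auto
    with unit have "\<forall>\<^sub>F t in at_right 0. norm (path t - (q + s *\<^sub>R v)) \<le> m * (1 - s / 4)"
    proof eventually_elim
      case (elim t)
      define e where "e = path t - q"
      have sm_le: "s * m \<le> m" using s m by simp
      have "norm (e - s *\<^sub>R v) \<le> m - s * m / 4"
      \<comment> \<open>A short \<open>e\<close> stays short after a step of length at most
        \<open>m / 4\<close>; only a long \<open>e\<close> satisfies the premise of
        \<open>sm\<close>.\<close>
      proof (cases "norm e \<le> m / 2")
        case True
        have "norm (e - s *\<^sub>R v) \<le> norm e + s * norm v" using norm_triangle_ineq4[of e "s *\<^sub>R v"] s by simp
        then show ?thesis using sv(1) sm_le True by linarith
      next
        case False
        have "s * norm v \<le> d * norm e" using sv(2) mult_left_mono[of "m / 2" "norm e" d] False d by linarith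
        then have "norm (e + s *\<^sub>R v) + norm (e - s *\<^sub>R v) \<le> 2 * norm e + m / (2 * (norm v + 1)) * (s * norm v)"
          using sm[of "s *\<^sub>R v" e] s by simp
        moreover have "(1 + s) * norm e \<le> norm (e + s *\<^sub>R v)"
          unfolding e_def v_def using elim(1) q s
          by (intro anchored_expands[OF T(1) path]) auto
        moreover have "m / (2 * (norm v + 1)) * (s * norm v) \<le> s * m / 2"
        proof -
          have "norm v / (norm v + 1) \<le> 1" using v1 by (simp add: pos_divide_le_eq)
          then have "(s * m / 2) * (norm v / (norm v + 1)) \<le> (s * m / 2) * 1"
            using s m by (intro mult_left_mono) auto
          then show ?thesis by (simp add: field_simps)
        qed
        moreover have "(1 + s) * norm e = norm e + s * norm e" by (simp add: distrib_right)
        moreover have "(1 - s) * norm e \<le> (1 - s) * (m + s * m / 8)"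
          using elim(2) s by (intro mult_left_mono) (auto simp: e_def)
        moreover have "(1 - s) * norm e = norm e - s * norm e" by (simp add: left_diff_distrib)
        moreover have "(1 - s) * (m + s * m / 8) \<le> m + s * m / 8 - s * m"
          using s m by (simp add: algebra_simps)
        ultimately show ?thesis using mult_pos_pos[OF s(1) m] by linarith
      qed
      then show ?case by (simp add: e_def algebra_simps)
    qed
    then have "q + s *\<^sub>R v \<in> eventual_cball (at_right 0) path (m * (1 - s / 4))" by (rule eventual_cballI)
    moreover have "m * (1 - s / 4) < m" using s m by (simp add: algebra_simps)
    ultimately show False using m_min qD by blast
  qed
  then have "(path \<longlongrightarrow> q) (at_right 0)"
    using q(3) by (intro tendstoI) (auto simp: dist_norm eventual_cball_def)
  then show ?thesis using that q by (auto simp: path_def)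
qed

text \<open>The map \<open>R\<close> from an anchor to the limit of its path is nonexpansive by
  \<open>anchored_le\<close>, so \<open>R\<close> after \<open>f\<close> has a fixed point
  \<open>q\<close>. The paths for \<open>f\<close> and for the constant \<open>f q\<close> differ by
  at most \<open>a * norm (xt D T f t - q)\<close>, which is absorbed on the left because
  \<open>a < 1\<close>.\<close>

theorem contraction_path_convergent:
  fixes D :: "'a::banach set"
  assumes smooth: "uniformly_smooth TYPE('a)" and D: "closed D" "convex D"
    and T: "nonexpansive_on D T" "fixpoints D T \<noteq> {}" and f: "f \<in> contractions D"
  obtains q where "q \<in> D" "T q = q" "(xt D T f \<longlongrightarrow> q) (at_right 0)"
    "(xt D T (\<lambda>_. f q) \<longlongrightarrow> q) (at_right 0)"
proof -
  have ne: "D \<noteq> {}" using T(2) by (auto simp: fixpoints_def)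
  obtain a where fD: "f ` D \<subseteq> D" and a: "0 < a" "a < 1"
    and fa: "\<And>x y. x \<in> D \<Longrightarrow> y \<in> D \<Longrightarrow> norm (f x - f y) \<le> a * norm (x - y)"
    using f by (auto simp: contractions_def)
  have unit: "\<forall>\<^sub>F t::real in at_right 0. 0 < t \<and> t \<le> 1"
    by (rule eventually_mono[OF eventually_at_right_real[of 0 1]]) auto
  have path: "xt D T (\<lambda>_. u) t \<in> D" "xt D T (\<lambda>_. u) t = t *\<^sub>R u + (1 - t) *\<^sub>R T (xt D T (\<lambda>_. u) t)"
    if "u \<in> D" "0 < t" "t \<le> 1" for u t
    by (rule xt_solves[OF D ne T(1), where a = 0]; use that in \<open>simp add: image_subset_iff\<close>)+
  have fpath: "xt D T f t \<in> D" "xt D T f t = t *\<^sub>R f (xt D T f t) + (1 - t) *\<^sub>R T (xt D T f t)"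
    if "0 < t" "t \<le> 1" for t
    by (rule xt_solves[OF D ne T(1) fD]; use fa a that in simp)+
  have "\<exists>q. q \<in> D \<and> T q = q \<and> (xt D T (\<lambda>_. u) \<longlongrightarrow> q) (at_right 0)" if "u \<in> D" for u
    using constant_path_convergent[OF smooth D T that] by blast
  then obtain R where R: "\<And>u. u \<in> D \<Longrightarrow> R u \<in> D" "\<And>u. u \<in> D \<Longrightarrow> T (R u) = R u"
    "\<And>u. u \<in> D \<Longrightarrow> (xt D T (\<lambda>_. u) \<longlongrightarrow> R u) (at_right 0)" by metis
  have R_le: "norm (R u - R v) \<le> norm (u - v)" if uv: "u \<in> D" "v \<in> D" for u v
  proof (rule tendsto_upperbound)
    show "((\<lambda>t. norm (xt D T (\<lambda>_. u) t - xt D T (\<lambda>_. v) t)) \<longlongrightarrow> norm (R u - R v)) (at_right 0)"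
      using R uv by (intro tendsto_intros)
    show "\<forall>\<^sub>F t in at_right 0. norm (xt D T (\<lambda>_. u) t - xt D T (\<lambda>_. v) t) \<le> norm (u - v)"
      using unit by (rule eventually_mono) (use uv in \<open>auto intro!: anchored_le[OF T(1)] path\<close>)
  qed simp
  have "\<exists>!q\<in>D. R (f q) = q"
  proof (rule Banach_fix)
    show "complete D" using D by (simp add: complete_eq_closed)
    show "(\<lambda>q. R (f q)) ` D \<subseteq> D" using R fD by auto
    fix x y assume xy: "x \<in> D" "y \<in> D"
    have "norm (R (f x) - R (f y)) \<le> norm (f x - f y)" using xy fD by (intro R_le) auto
    then show "dist (R (f x)) (R (f y)) \<le> a * dist x y" using fa[OF xy] by (simp add: dist_norm)
  qed (use a ne in auto)
  then obtain q where q: "q \<in> D" "R (f q) = q" by auto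
  have fq: "f q \<in> D" using fD q by auto
  have lim: "(xt D T (\<lambda>_. f q) \<longlongrightarrow> q) (at_right 0)" using R(3)[OF fq] q by simp
  have "((\<lambda>t. xt D T f t - q) \<longlongrightarrow> 0) (at_right 0)"
  proof (rule Lim_null_comparison)
    show "\<forall>\<^sub>F t in at_right 0. norm (xt D T f t - q) \<le> inverse (1 - a) * norm (xt D T (\<lambda>_. f q) t - q)"
      using unit
    proof (rule eventually_mono)
      fix t :: real assume "0 < t \<and> t \<le> 1"
      then have t: "0 < t" "t \<le> 1" by auto
      let ?x = "xt D T f t" and ?w = "xt D T (\<lambda>_. f q) t"
      have "norm (?x - ?w) \<le> norm (f ?x - f q)"
        using anchored_le[OF T(1) fpath(1)[OF t] path(1)[OF fq t] fpath(2)[OF t] path(2)[OF fq t] t] .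
      also have "\<dots> \<le> a * norm (?x - q)" using fa fpath(1)[OF t] q(1) by simp
      finally have "norm (?x - q) \<le> a * norm (?x - q) + norm (?w - q)"
        using norm_triangle_ineq[of "?x - ?w" "?w - q"] by simp
      then have "(1 - a) * norm (?x - q) \<le> norm (?w - q)" by (simp add: algebra_simps)
      then show "norm (?x - q) \<le> inverse (1 - a) * norm (?w - q)" using a by (simp add: field_simps)
    qed
    show "((\<lambda>t. inverse (1 - a) * norm (xt D T (\<lambda>_. f q) t - q)) \<longlongrightarrow> 0) (at_right 0)"
      using lim by (intro tendsto_mult_right_zero tendsto_norm_zero LIM_zero)
  qed
  then have "(xt D T f \<longlongrightarrow> q) (at_right 0)" by (rule LIM_zero_cancel)
  then show ?thesis using that q R(2)[OF fq] lim by auto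
qed

section \<open>The iteration\<close>

text \<open>Subtracting the partial sums of \<open>c\<close> makes \<open>b\<close> eventually
  decreasing, so \<open>b\<close> converges. The decrements dominate \<open>g n * b n\<close> and
  telescope; a positive limit would make \<open>g\<close> summable.\<close>

lemma recursive_inequality_tendsto_zero:
  fixes b c g :: "nat \<Rightarrow> real"
  assumes b: "\<And>n. 0 \<le> b n" and c: "\<And>n. 0 \<le> c n" "summable c"
    and g: "\<And>n. 0 \<le> g n" "\<not> summable g"
    and rec: "\<forall>\<^sub>F n in sequentially. b (Suc n) \<le> (1 - g n) * b n + c n"
  shows "b \<longlonglongrightarrow> 0"
proof -
  obtain N where N: "\<And>n. n \<ge> N \<Longrightarrow> b (Suc n) \<le> (1 - g n) * b n + c n"
    using rec unfolding eventually_sequentially by blast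
  define B where "B n = b (n + N) - sum c {..<n + N}" for n
  have step: "g (n + N) * b (n + N) \<le> B n - B (Suc n)" for n
    using N[of "n + N"] by (simp add: B_def algebra_simps)
  have "decseq B"
  proof (rule decseq_SucI)
    show "B (Suc n) \<le> B n" for n
      using step[of n] mult_nonneg_nonneg[OF g(1)[of "n + N"] b[of "n + N"]] by linarith
  qed
  moreover have low: "- suminf c \<le> B n" for n
    using sum_le_suminf[OF c(2), of "{..<n + N}"] c(1) b[of "n + N"] by (simp add: B_def)
  ultimately obtain l where l: "B \<longlonglongrightarrow> l" using decseq_convergent by blast
  have "(\<lambda>n. sum c {..<n + N}) \<longlonglongrightarrow> suminf c"
    using LIMSEQ_ignore_initial_segment[OF summable_LIMSEQ[OF c(2)], of N] .
  from tendsto_add[OF l this] have lim: "(\<lambda>n. b (n + N)) \<longlonglongrightarrow> l + suminf c"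
    by (simp add: B_def)
  define h where "h = l + suminf c"
  have "h \<ge> 0" using LIMSEQ_le_const[OF lim, of 0] b by (auto simp: h_def)
  have "h = 0"
  proof (rule ccontr)
    assume "h \<noteq> 0"
    with \<open>h \<ge> 0\<close> have h: "h / 2 < h" "0 < h" by auto
    have "\<forall>\<^sub>F n in sequentially. h / 2 < b (n + N)"
      using order_tendstoD(1)[OF lim[folded h_def] h(1)] .
    then obtain K where K: "\<And>n. n \<ge> K \<Longrightarrow> h / 2 < b (n + N)"
      unfolding eventually_sequentially by blast
    have sm: "summable (\<lambda>n. g (n + N) * b (n + N))"
    proof (rule summableI_nonneg_bounded)
      show "0 \<le> g (n + N) * b (n + N)" for n using g b by simp
      fix n
      have "(\<Sum>i<n. g (i + N) * b (i + N)) \<le> (\<Sum>i<n. B i - B (Suc i))" by (intro sum_mono step)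
      also have "\<dots> = B 0 - B n" by (rule sum_lessThan_telescope')
      also have "\<dots> \<le> B 0 + suminf c" using low[of n] by simp
      finally show "(\<Sum>i<n. g (i + N) * b (i + N)) \<le> B 0 + suminf c" .
    qed
    have "summable (\<lambda>n. g (n + N) * (h / 2))"
    proof (rule summable_comparison_test'[OF sm])
      show "norm (g (n + N) * (h / 2)) \<le> g (n + N) * b (n + N)" if "n \<ge> K" for n
        using mult_left_mono[OF less_imp_le[OF K[OF that]] g(1)[of "n + N"]] g(1)[of "n + N"] h by simp
    qed
    then have "summable (\<lambda>n. g (n + N))" using h summable_mult2[of "\<lambda>n. g (n + N) * (h / 2)" "2 / h"] by simp
    then show False using g(2) by (simp add: summable_iff_shift)
  qed
  then show ?thesis using lim LIMSEQ_offset[of b N 0] by (simp add: h_def)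
qed

text \<open>A path point \<open>w\<close> near \<open>q\<close> is fixed first;
  \<open>anchored_ray\<close> then has error \<open>norm (T (x n) - x n) / t\<close> with
  \<open>t\<close> fixed, which vanishes as \<open>n\<close> grows. This replaces the usual limsup
  inequality for the duality mapping.\<close>

lemma asymptotic_variational_inequality:
  fixes D :: "'a::banach set" and x :: "nat \<Rightarrow> 'a"
  assumes D: "closed D" "convex D" and T: "nonexpansive_on D T" and u: "u \<in> D"
    and lim: "(xt D T (\<lambda>_. u) \<longlongrightarrow> q) (at_right 0)"
    and x: "\<And>n. x n \<in> D" "(\<lambda>n. norm (T (x n) - x n)) \<longlonglongrightarrow> 0"
    and s: "0 \<le> s" "s \<le> 1" and e: "e > 0"
  shows "\<forall>\<^sub>F n in sequentially. norm (x n - q) \<le> norm ((x n - q) - s *\<^sub>R (u - q)) + e"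
proof -
  have ne: "D \<noteq> {}" using u by auto
  have "\<forall>\<^sub>F t in at_right 0. dist (xt D T (\<lambda>_. u) t) q < e / 4"
    using tendstoD[OF lim, of "e / 4"] e by simp
  moreover have "\<forall>\<^sub>F t::real in at_right 0. t \<in> {0<..<1}"
    by (rule eventually_at_right_real) simp
  ultimately have "\<forall>\<^sub>F t::real in at_right 0. dist (xt D T (\<lambda>_. u) t) q < e / 4 \<and> t \<in> {0<..<1}"
    by (rule eventually_conj)
  from eventually_happens'[OF trivial_limit_at_right_real this]
  obtain t :: real where t: "0 < t" "t < 1" and near: "dist (xt D T (\<lambda>_. u) t) q < e / 4" by auto
  define w where "w = xt D T (\<lambda>_. u) t"
  have wq: "norm (w - q) < e / 4" using near by (simp add: w_def dist_norm)
  have w: "w \<in> D" "w = t *\<^sub>R u + (1 - t) *\<^sub>R T w"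
    unfolding w_def
    by (rule xt_solves[OF D ne T, where a = 0]; use u t in \<open>simp add: image_subset_iff\<close>)+
  have "\<forall>\<^sub>F n in sequentially. norm (T (x n) - x n) < t * (e / 4)"
    using order_tendstoD(2)[OF x(2), of "t * (e / 4)"] t e by simp
  then show ?thesis
  proof (rule eventually_mono)
    fix n assume n: "norm (T (x n) - x n) < t * (e / 4)"
    have "norm (w - x n) \<le> norm ((w - x n) + s *\<^sub>R (u - w)) + norm (T (x n) - x n) / t"
      using t by (intro anchored_ray[OF T w _ _ x(1) s]) auto
    also have "norm (T (x n) - x n) / t \<le> e / 4" using n t by (simp add: pos_divide_le_eq mult.commute)
    finally have 1: "norm (w - x n) \<le> norm ((w - x n) + s *\<^sub>R (u - w)) + e / 4" by simp
    have 2: "norm (x n - q) \<le> norm (w - x n) + norm (w - q)"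
      using norm_triangle_ineq4[of "w - q" "w - x n"] by simp
    have "(w - x n) + s *\<^sub>R (u - w) = (1 - s) *\<^sub>R (w - q) - ((x n - q) - s *\<^sub>R (u - q))"
      by (simp add: algebra_simps)
    then have "norm ((w - x n) + s *\<^sub>R (u - w)) \<le> norm ((1 - s) *\<^sub>R (w - q)) + norm ((x n - q) - s *\<^sub>R (u - q))"
      by (simp only: norm_triangle_ineq4)
    moreover have "norm ((1 - s) *\<^sub>R (w - q)) \<le> norm (w - q)"
      using s by (simp add: mult_left_le_one_le)
    ultimately show "norm (x n - q) \<le> norm ((x n - q) - s *\<^sub>R (u - q)) + e"
      using 1 2 wq e by linarith
  qed
qed

text \<open>The iteration uses varying step sizes, so the error must be proportional to
  \<open>a\<close>. Smoothness turns the inequality for one step \<open>s\<close> into an upper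
  bound at \<open>z + s *\<^sub>R v\<close>, where \<open>z = x n - q\<close> and
  \<open>v = u - q\<close>. As \<open>z\<close> lies between \<open>z - a *\<^sub>R v\<close> and
  \<open>z + s *\<^sub>R v\<close>, convexity yields every \<open>a\<close>. The lower bound
  \<open>k\<close> lets one \<open>s\<close> serve all \<open>n\<close>.\<close>

lemma uniform_descent:
  fixes D :: "'a::banach set" and x :: "nat \<Rightarrow> 'a"
  assumes smooth: "uniformly_smooth TYPE('a)"
    and D: "closed D" "convex D" and T: "nonexpansive_on D T" and u: "u \<in> D"
    and lim: "(xt D T (\<lambda>_. u) \<longlongrightarrow> q) (at_right 0)"
    and x: "\<And>n. x n \<in> D" "(\<lambda>n. norm (T (x n) - x n)) \<longlonglongrightarrow> 0"
    and k: "k > 0" and e: "e > 0"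
  shows "\<forall>\<^sub>F n in sequentially. k \<le> norm (x n - q) \<longrightarrow>
    (\<forall>a\<ge>0. norm (x n - q) \<le> norm ((x n - q) - a *\<^sub>R (u - q)) + a * e)"
proof -
  define v where "v = u - q"
  have v1: "norm v + 1 > 0" by (simp add: add_nonneg_pos)
  have "e / (2 * (norm v + 1)) > 0" using e v1 by simp
  then obtain d where d: "d > 0" and sm: "\<And>x y::'a. norm y \<le> d * norm x \<Longrightarrow>
      norm (x + y) + norm (x - y) \<le> 2 * norm x + e / (2 * (norm v + 1)) * norm y"
    using uniformly_smooth_norm_sum[OF smooth] by blast
  define s where "s = min 1 (d * k / (norm v + 1))"
  have s: "0 < s" "s \<le> 1" using d k v1 by (auto simp: s_def)
  have sv: "s * norm v \<le> d * k"
  proof -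
    have "s * norm v \<le> s * (norm v + 1)" using s by simp
    also have "\<dots> \<le> d * k / (norm v + 1) * (norm v + 1)"
      using v1 by (intro mult_right_mono) (auto simp: s_def)
    also have "\<dots> = d * k" using v1 by simp
    finally show ?thesis .
  qed
  have "\<forall>\<^sub>F n in sequentially. norm (x n - q) \<le> norm ((x n - q) - s *\<^sub>R (u - q)) + s * e / 2"
    using s e by (intro asymptotic_variational_inequality[OF D T u lim x]) auto
  then show ?thesis
  proof (rule eventually_mono, intro impI allI)
    fix n and a :: real
    assume low: "norm (x n - q) \<le> norm ((x n - q) - s *\<^sub>R (u - q)) + s * e / 2"
      and big: "k \<le> norm (x n - q)" and a: "0 \<le> a"
    define z where "z = x n - q"
    have "d * k \<le> d * norm z" using big d by (simp add: z_def)
    then have "norm (s *\<^sub>R v) \<le> d * norm z" using sv s by simp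
    from sm[OF this] have "norm (z + s *\<^sub>R v) + norm (z - s *\<^sub>R v) \<le> 2 * norm z + e / (2 * (norm v + 1)) * (s * norm v)"
      using s by simp
    moreover have "e / (2 * (norm v + 1)) * (s * norm v) \<le> s * e / 2"
    proof -
      have "norm v / (norm v + 1) \<le> 1" using v1 by (simp add: pos_divide_le_eq)
      then have "(s * e / 2) * (norm v / (norm v + 1)) \<le> (s * e / 2) * 1"
        using s e by (intro mult_left_mono) auto
      then show ?thesis by (simp add: field_simps)
    qed
    ultimately have up: "norm (z + s *\<^sub>R v) \<le> norm z + s * e"
      using low unfolding z_def v_def by linarith
    have "(a + s) *\<^sub>R z = s *\<^sub>R (z - a *\<^sub>R v) + a *\<^sub>R (z + s *\<^sub>R v)" by (simp add: algebra_simps)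
    then have "norm ((a + s) *\<^sub>R z) \<le> norm (s *\<^sub>R (z - a *\<^sub>R v)) + norm (a *\<^sub>R (z + s *\<^sub>R v))"
      by (simp only: norm_triangle_ineq)
    then have "(a + s) * norm z \<le> s * norm (z - a *\<^sub>R v) + a * norm (z + s *\<^sub>R v)"
      using a s by simp
    also have "\<dots> \<le> s * norm (z - a *\<^sub>R v) + a * (norm z + s * e)"
      using up a by (intro add_left_mono mult_left_mono)
    finally have "s * norm z \<le> s * (norm (z - a *\<^sub>R v) + a * e)" by (simp add: algebra_simps)
    then show "norm (x n - q) \<le> norm ((x n - q) - a *\<^sub>R (u - q)) + a * e"
      using s by (simp add: z_def v_def)
  qed
qed

theorem theorem2p1:
  fixes D :: "'a::banach set"
    and T f :: "'a \<Rightarrow> 'a"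
    and fn gn :: "nat \<Rightarrow> 'a \<Rightarrow> 'a"
    and \<alpha> \<beta> \<delta> :: "nat \<Rightarrow> real"
    and x y :: "nat \<Rightarrow> 'a"
    and L M :: real
  assumes smooth: "uniformly_smooth TYPE('a)"
    and D: "D \<noteq> {}" "closed D" "convex D"
    and T: "nonexpansive_on D T" "fixpoints D T \<noteq> {}"
    and fn_maps: "\<And>n. fn n ` D \<subseteq> D"
    and gn_maps: "\<And>n. gn n ` D \<subseteq> D"
    and x0: "x 0 \<in> D"
    and y_def: "\<And>n. y n = \<beta> n *\<^sub>R gn n (x n) + (1 - \<beta> n) *\<^sub>R T (x n)"
    and x_rec: "\<And>n. x (Suc n) = \<alpha> n *\<^sub>R fn n (x n) + (1 - \<alpha> n) *\<^sub>R T (y n)"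
    and L: "0 < L" "L < 1"
    and fn_lip: "\<And>n u v. u \<in> D \<Longrightarrow> v \<in> D \<Longrightarrow> norm (fn n u - fn n v) \<le> L * norm (u - v)"
    and f: "f \<in> contractions D" "uniform_limit D fn f sequentially"
    and M: "M > 0"
    and \<delta>: "\<And>n. \<delta> n \<ge> 0" "summable \<delta>"
    and gn_bound: "\<And>n u. u \<in> D \<Longrightarrow> \<beta> n * norm (gn n u - u) \<le> \<delta> n * (norm u + M)"
    and \<alpha>: "\<And>n. 0 \<le> \<alpha> n" "\<And>n. \<alpha> n \<le> 1" "\<alpha> \<longlonglongrightarrow> 0" "\<not> summable \<alpha>"
    and \<beta>: "\<And>n. 0 < \<beta> n" "\<And>n. \<beta> n \<le> 1"
    and bdd: "bounded (range x)"
    and asym: "(\<lambda>n. norm (T (x n) - x n)) \<longlonglongrightarrow> 0"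
  shows "x \<longlonglongrightarrow> Qmap D T f"
proof -
  obtain q where q: "q \<in> D" "T q = q" "(xt D T f \<longlongrightarrow> q) (at_right 0)"
    "(xt D T (\<lambda>_. f q) \<longlongrightarrow> q) (at_right 0)"
    using contraction_path_convergent[OF smooth D(2,3) T f(1)] by blast
  have Q: "Qmap D T f = q"
    unfolding Qmap_def using q(3) by (intro tendsto_Lim) auto
  have fq: "f q \<in> D" using f(1) q(1) by (auto simp: contractions_def)
  have T_D: "T z \<in> D" if "z \<in> D" for z using T(1) that by (auto simp: nonexpansive_on_def)
  have T_le: "norm (T a - T b) \<le> norm (a - b)" if "a \<in> D" "b \<in> D" for a b
    using T(1) that by (auto simp: nonexpansive_on_def)
  have yD: "y n \<in> D" if "x n \<in> D" for n
    unfolding y_def using gn_maps[of n] that T_D[OF that] \<beta>[of n]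
    by (intro convexD[OF D(3)]) (auto simp: less_imp_le)
  have xD: "x n \<in> D" for n
  proof (induction n)
    case (Suc n)
    show ?case
      unfolding x_rec using fn_maps[of n] Suc T_D[OF yD[OF Suc]] \<alpha>(1,2)[of n]
      by (intro convexD[OF D(3)]) auto
  qed (rule x0)
  obtain B where B: "\<And>n. norm (x n) \<le> B" using bdd by (auto simp: bounded_iff)
  define c where "c n = \<delta> n * (B + M)" for n
  have c: "0 \<le> c n" "summable c" for n
  proof -
    have "0 \<le> B + M" using B[of 0] M norm_ge_zero[of "x 0"] by linarith
    then show "0 \<le> c n" using \<delta>(1)[of n] by (simp add: c_def)
    show "summable c" unfolding c_def using \<delta>(2) by (rule summable_mult2)
  qed
  have Ty: "norm (T (y n) - q) \<le> norm (x n - q) + c n" for n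
  proof -
    have "norm (T (y n) - q) \<le> norm (y n - q)" using T_le[OF yD[OF xD] q(1)] q(2) by simp
    \<comment> \<open>Splitting off \<open>gn n (x n) - x n\<close> leaves a convex combination of
      \<open>x n - q\<close> and \<open>T (x n) - T q\<close>, both no longer than
      \<open>x n - q\<close>.\<close>
    also have "y n - q = \<beta> n *\<^sub>R (gn n (x n) - x n) + (\<beta> n *\<^sub>R (x n - q) + (1 - \<beta> n) *\<^sub>R (T (x n) - T q))"
      by (simp add: y_def q(2) algebra_simps)
    also have "norm \<dots> \<le> norm (\<beta> n *\<^sub>R (gn n (x n) - x n))
        + (norm (\<beta> n *\<^sub>R (x n - q)) + norm ((1 - \<beta> n) *\<^sub>R (T (x n) - T q)))"
      by (rule order_trans[OF norm_triangle_ineq add_left_mono[OF norm_triangle_ineq]])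
    also have "\<dots> = \<beta> n * norm (gn n (x n) - x n) + (\<beta> n * norm (x n - q) + (1 - \<beta> n) * norm (T (x n) - T q))"
      using \<beta>[of n] by simp
    also have "\<dots> \<le> \<delta> n * (norm (x n) + M) + (\<beta> n * norm (x n - q) + (1 - \<beta> n) * norm (x n - q))"
      using gn_bound[OF xD, of n n] T_le[OF xD q(1), of n] \<beta>[of n]
      by (intro add_mono mult_left_mono) auto
    also have "\<dots> \<le> c n + (\<beta> n * norm (x n - q) + (1 - \<beta> n) * norm (x n - q))"
      unfolding c_def using B[of n] \<delta>(1)[of n] by (intro add_right_mono mult_left_mono) auto
    also have "\<dots> = norm (x n - q) + c n" by (simp add: algebra_simps)
    finally show ?thesis .
  qed
  define g where "g n = \<alpha> n * (1 - L)" for n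
  have g: "0 \<le> g n" "g n \<le> 1" "\<not> summable g" for n
  proof -
    show "0 \<le> g n" using \<alpha>(1)[of n] L by (simp add: g_def)
    show "g n \<le> 1" using mult_mono[of "\<alpha> n" 1 "1 - L" 1] \<alpha>(1,2)[of n] L by (simp add: g_def)
    show "\<not> summable g"
    proof
      assume "summable g"
      from summable_mult2[OF this, of "inverse (1 - L)"] have "summable \<alpha>"
        using L by (simp add: g_def mult.assoc)
      then show False using \<alpha>(4) by simp
    qed
  qed
  have fn_lim: "(\<lambda>n. fn n q) \<longlonglongrightarrow> f q" using tendsto_uniform_limitI[OF f(2) q(1)] .
  have "x \<longlonglongrightarrow> q"
  proof (rule metric_LIMSEQ_I)
    fix r :: real assume r: "r > 0"
    define k where "k = r / 2"
    have k: "k > 0" using r by (simp add: k_def)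
    \<comment> \<open>Two errors \<open>\<alpha> n * e\<close> occur, from
      \<open>fn n q - f q\<close> and from the descent; together they equal
      \<open>g n * k\<close>.\<close>
    define e where "e = (1 - L) * k / 2"
    have e: "e > 0" using k L by (simp add: e_def)
    \<comment> \<open>The descent is available only at distance at least \<open>k\<close> from
      \<open>q\<close>, so the recursion is run for the excess over \<open>k\<close>; below
      \<open>k\<close> it is 0.\<close>
    define b where "b n = max 0 (norm (x n - q) - k)" for n
    \<comment> \<open>The descent is used at the new iterate, with
      \<open>a = \<alpha> n\<close>.\<close>
    have "\<forall>\<^sub>F n in sequentially. k \<le> norm (x (Suc n) - q) \<longrightarrow>
      (\<forall>a\<ge>0. norm (x (Suc n) - q) \<le> norm ((x (Suc n) - q) - a *\<^sub>R (f q - q)) + a * e)"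
      using uniform_descent[OF smooth D(2,3) T(1) fq q(4) xD asym k e]
      by (subst eventually_sequentially_Suc)
    moreover have "\<forall>\<^sub>F n in sequentially. norm (fn n q - f q) < e"
      using tendstoD[OF fn_lim e] by (simp add: dist_norm)
    ultimately have "\<forall>\<^sub>F n in sequentially. b (Suc n) \<le> (1 - g n) * b n + c n"
    proof eventually_elim
      case (elim n)
      have b0: "0 \<le> (1 - g n) * b n + c n" using g(2)[of n] c(1)[of n] by (simp add: b_def)
      show ?case
      proof (cases "k \<le> norm (x (Suc n) - q)")
        case False
        then show ?thesis using b0 by (simp add: b_def)
      next
        case True
        \<comment> \<open>The subtracted term replaces \<open>q\<close> by \<open>f q\<close> in the
          anchor part, which then splits into a contracted difference and a vanishing one.\<close>
        have "x (Suc n) - q - \<alpha> n *\<^sub>R (f q - q)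
            = \<alpha> n *\<^sub>R ((fn n (x n) - fn n q) + (fn n q - f q)) + (1 - \<alpha> n) *\<^sub>R (T (y n) - q)"
          by (simp add: x_rec algebra_simps)
        then have "norm (x (Suc n) - q - \<alpha> n *\<^sub>R (f q - q))
            \<le> \<alpha> n * norm ((fn n (x n) - fn n q) + (fn n q - f q)) + (1 - \<alpha> n) * norm (T (y n) - q)"
          using norm_triangle_ineq[of "\<alpha> n *\<^sub>R ((fn n (x n) - fn n q) + (fn n q - f q))" "(1 - \<alpha> n) *\<^sub>R (T (y n) - q)"]
            \<alpha>(1,2)[of n] by simp
        also have "\<dots> \<le> \<alpha> n * (L * norm (x n - q) + e) + (1 - \<alpha> n) * (norm (x n - q) + c n)"
        proof (intro add_mono mult_left_mono)
          show "norm ((fn n (x n) - fn n q) + (fn n q - f q)) \<le> L * norm (x n - q) + e"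
            using norm_triangle_ineq[of "fn n (x n) - fn n q" "fn n q - f q"] fn_lip[OF xD q(1), of n n] elim(2)
            by linarith
        qed (use Ty \<alpha>(1,2)[of n] in auto)
        finally have "norm (x (Suc n) - q) \<le> \<alpha> n * (L * norm (x n - q) + e) + (1 - \<alpha> n) * (norm (x n - q) + c n) + \<alpha> n * e"
          using elim(1) True \<alpha>(1)[of n] by fastforce
        also have "\<dots> = (1 - g n) * norm (x n - q) + g n * k + (c n - \<alpha> n * c n)"
          by (simp add: g_def e_def field_simps)
        also have "\<dots> \<le> (1 - g n) * norm (x n - q) + g n * k + c n"
          using mult_nonneg_nonneg[OF \<alpha>(1) c(1), of n n] by simp
        finally have "norm (x (Suc n) - q) - k \<le> (1 - g n) * (norm (x n - q) - k) + c n"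
          by (simp add: algebra_simps)
        also have "\<dots> \<le> (1 - g n) * b n + c n"
          using g(2)[of n] by (intro add_right_mono mult_left_mono) (auto simp: b_def)
        finally show ?thesis using b0 by (simp add: b_def)
      qed
    qed
    then have "b \<longlonglongrightarrow> 0"
      by (intro recursive_inequality_tendsto_zero[OF _ c g(1,3)]) (auto simp: b_def)
    then have "\<forall>\<^sub>F n in sequentially. b n < k" using order_tendstoD(2) k by blast
    then obtain N where N: "\<And>n. n \<ge> N \<Longrightarrow> b n < k" unfolding eventually_sequentially by blast
    \<comment> \<open>An excess below \<open>k\<close> means a distance below
      \<open>2 * k = r\<close>.\<close>
    have "dist (x n) q < r" if "n \<ge> N" for n
      using N[OF that] unfolding b_def k_def dist_norm by linarith
    then show "\<exists>N. \<forall>n\<ge>N. dist (x n) q < r" by blast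
  qed
  then show ?thesis by (simp add: Q)
qed

end
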